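(* Consider the time-varying problem $$\min_x\ \hat f(x-c(t))\quad\text{subject to}\quad Ux\le v(t),\qquad t\ge0.$$ Define $\hat{\mathcal X}(t):=\{x: Ux\le v(t)\}$ and let (i) $\hat f:\mathbb R^n\to\mathbb R$ be twice continuously differentiable and $\alpha$-strongly convex, with $\nabla\hat f$ $\beta$-Lipschitz; (ii) $c:\mathbb R_{\ge0}\to\mathbb R^n$ and $v:\mathbb R_{\ge0}\to\mathbb R^m$ be $\ell_c$- and $\ell_v$-Lipschitz continuous, respectively; (iii) $U\in\mathbb R^{m\times n}$ and $\omega>0$ be such that for every $t\ge0$ and every $x\in\hat{\mathcal X}(t)$ one has $\omega^2\mathbb I\preceq U_{\mathbf I^t_x}U_{\mathbf I^t_x}^\top$. If $\hat{\mathcal X}(t)\neq\emptyset$ for all $t\ge0$, then the sweeping gradient flow $$\dot x\in-\boldsymbol{\nabla}\hat f(x-c(t))-N_x\hat{\mathcal X}(t)$$ admits a complete solution $x:\mathbb R_{\ge0}\to\mathbb R^n$ for every initial condition $x(0)\in\hat{\mathcal X}(0)$, and it holds that $$\limsup_{t\to\infty}\|x(t)-x^\star(t)\|\le\frac{\ell_t}{\alpha}:=\frac{\beta^{1/2}}{\alpha^{3/2}}\left(\frac{\beta\ell_c}{\alpha}+\frac{\ell_v}{\omega}\right),$$ where $x^\star(t)$ is the unique optimizer of the problem at time $t$. Furthermore, if $\|x(0)-x^\star(0)\|\le\frac{\ell_t}{\alpha}$, then $\|x(t)-x^\star(t)\|\le\frac{\ell_t}{\alpha}$ holds for all $t\g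e0$.
   Context: For $x\in\hat{\mathcal X}(t)$, $\mathbf I^t_x$ is the set of indices $i$ with $(Ux)_i=v_i(t)$, and $U_{\mathbf I}$ is the submatrix of $U$ consisting of the rows with indices in $\mathbf I$ (condition (iii) is vacuous if $\mathbf I^t_x=\emptyset$). $\boldsymbol\nabla\hat f$ is the gradient (column vector). $A\preceq B$ means $B-A$ is positive semidefinite, $\mathbb I$ is the identity matrix, $\|\cdot\|$ is the Euclidean norm. The normal cone of a nonempty convex set $\mathcal X$ at $x\in\mathcal X$ is $N_x\mathcal X:=\mathrm{cl}\{\eta:\ \langle\eta,y-x\rangle\le0\ \ \forall y\in\mathcal X\}$. A solution on $[0,T]$ of the differential inclusion $\dot x\in\Phi(x,t)-N_x\mathcal X(t)$ is an absolutely continuous map $x:[0,T]\to\mathbb R^n$ that satisfies the inclusion for almost all $t\in[0,T]$ and $x(t)\in\mathcal X(t)$ for all $t\in[0,T]$. A complete solution is a map $x:\mathbb R_{\ge0}\to\mathbb R^n$, absolutely continuous (on compact intervals), whose restriction to every compact interval $[0,T]$, $T>0$, is a solution. *)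

theory Defs
  imports "HOL-Analysis.Analysis"
begin

definition gradient :: "('a::real_inner \<Rightarrow> real) \<Rightarrow> 'a \<Rightarrow> 'a" where
  "gradient f x = (THE g. GDERIV f x :> g)"

(* The derivative of the gradient, H x, is the Hessian; continuity is in operator norm. *)
definition twice_continuously_differentiable :: "('a::euclidean_space \<Rightarrow> real) \<Rightarrow> bool" where
  "twice_continuously_differentiable f \<longleftrightarrow>
     (\<forall>x. f differentiable at x) \<and>
     (\<exists>H :: 'a \<Rightarrow> 'a \<Rightarrow>\<^sub>L 'a.
        (\<forall>x. (gradient f has_derivative blinfun_apply (H x)) (at x)) \<and> continuous_on UNIV H)"

definition strongly_convex :: "real \<Rightarrow> ('a::real_inner \<Rightarrow> real) \<Rightarrow> bool" where
  "strongly_convex \<alpha> f \<longleftrightarrow> 0 < \<alpha> \<and>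
     (\<forall>x y. \<forall>u\<in>{0..1}. f ((1 - u) *\<^sub>R x + u *\<^sub>R y)
        \<le> (1 - u) * f x + u * f y - \<alpha> / 2 * u * (1 - u) * (norm (x - y))\<^sup>2)"

(* Matrices whose rows (and columns) are indexed by a subset I of a finite type are
   represented by functions; only entries with indices in I are meaningful. *)

definition row_submatrix :: "real^'n^'m \<Rightarrow> 'm set \<Rightarrow> 'm \<Rightarrow> 'n \<Rightarrow> real" where
  "row_submatrix U I = (\<lambda>i\<in>I. \<lambda>j. U $ i $ j)"

definition times_transpose :: "('m \<Rightarrow> 'n::finite \<Rightarrow> real) \<Rightarrow> 'm \<Rightarrow> 'm \<Rightarrow> real" where
  "times_transpose A = (\<lambda>i k. \<Sum>j\<in>UNIV. A i j * A k j)"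

definition scaled_identity :: "real \<Rightarrow> 'm \<Rightarrow> 'm \<Rightarrow> real" where
  "scaled_identity r = (\<lambda>i k. if i = k then r else 0)"

definition psd_on :: "'m set \<Rightarrow> ('m \<Rightarrow> 'm \<Rightarrow> real) \<Rightarrow> bool" where
  "psd_on I A \<longleftrightarrow> (\<forall>i\<in>I. \<forall>k\<in>I. A i k = A k i) \<and>
     (\<forall>z. 0 \<le> (\<Sum>i\<in>I. \<Sum>k\<in>I. z i * A i k * z k))"

definition loewner_le_on :: "'m set \<Rightarrow> ('m \<Rightarrow> 'm \<Rightarrow> real) \<Rightarrow> ('m \<Rightarrow> 'm \<Rightarrow> real) \<Rightarrow> bool" where
  "loewner_le_on I A B \<longleftrightarrow> psd_on I (\<lambda>i k. B i k - A i k)"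

(* The order on real^'m is componentwise. *)
definition feasible :: "real^'n^'m \<Rightarrow> real^'m \<Rightarrow> (real^'n) set" where
  "feasible U b = {x. U *v x \<le> b}"

definition active :: "real^'n^'m \<Rightarrow> real^'m \<Rightarrow> real^'n \<Rightarrow> 'm set" where
  "active U b x = {i. (U *v x) $ i = b $ i}"

definition normal_cone :: "'a::real_inner set \<Rightarrow> 'a \<Rightarrow> 'a set" where
  "normal_cone X x = closure {\<eta>. \<forall>y\<in>X. \<eta> \<bullet> (y - x) \<le> 0}"

(* The usual epsilon-delta definition; the family D of nonoverlapping compact subintervals
   is given as a division of its union. *)
definition absolutely_continuous_on :: "real set \<Rightarrow> (real \<Rightarrow> 'a::real_normed_vector) \<Rightarrow> bool" where
  "absolutely_continuous_on S x \<longleftrightarrow>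
     (\<forall>\<epsilon>>0. \<exists>\<delta>>0. \<forall>D. D division_of (\<Union>D) \<and> \<Union>D \<subseteq> S \<and> (\<Sum>K\<in>D. Sup K - Inf K) < \<delta> \<longrightarrow>
        (\<Sum>K\<in>D. norm (x (Sup K) - x (Inf K))) < \<epsilon>)"

(* Solutions of x' \<in> \<Phi>(x,t) - N_x X(t). *)

definition sweeping_solution ::
    "('a::euclidean_space \<Rightarrow> real \<Rightarrow> 'a set) \<Rightarrow> (real \<Rightarrow> 'a set) \<Rightarrow> real \<Rightarrow> (real \<Rightarrow> 'a) \<Rightarrow> bool" where
  "sweeping_solution \<Phi> X T x \<longleftrightarrow>
     absolutely_continuous_on {0..T} x \<and>
     (\<forall>t\<in>{0..T}. x t \<in> X t) \<and>
     (AE t in lebesgue_on {0..T}. \<exists>p\<in>\<Phi> (x t) t. \<exists>\<eta>\<in>normal_cone (X t) (x t).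
        (x has_vector_derivative (p - \<eta>)) (at t within {0..T}))"

(* Values at negative times are irrelevant. *)
definition complete_sweeping_solution ::
    "('a::euclidean_space \<Rightarrow> real \<Rightarrow> 'a set) \<Rightarrow> (real \<Rightarrow> 'a set) \<Rightarrow> (real \<Rightarrow> 'a) \<Rightarrow> bool" where
  "complete_sweeping_solution \<Phi> X x \<longleftrightarrow> (\<forall>T>0. sweeping_solution \<Phi> X T x)"

end

theory Submission
  imports Defs
begin

text \<open>
  The lower bound on the Gram matrices of the active rows enters only through one consequence: at
  every feasible point these rows of \<open>U\<close> have a right inverse of norm at most \<open>1 / \<omega>\<close>
  (\<open>bounded_right_inverse_of_rows\<close>). A change \<open>\<Delta>v\<close> of the bounds can therefore be undone, as far as
  the active constraints are concerned, by a translation of length at most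
  \<open>\<parallel>\<Delta>v\<parallel> / \<omega>\<close>. Translating test points in this way takes the place of Lagrange multipliers
  throughout. Applied to a projection, it shows that the feasible set moves with Hausdorff speed at
  most \<open>lv / \<omega>\<close> (\<open>feasible_hausdorff_lipschitz\<close>).

  The optimizer moves with speed at most
  \<open>\<beta> / \<alpha> * lc + sqrt (\<beta> / \<alpha>) * lv / \<omega>\<close>. When only \<open>c\<close> changes, the two variational inequalities
  live on the same set and strong monotonicity gives the first term. When only \<open>v\<close> changes, the
  optimizers at nearby times have active sets contained in a common one; the translation above
  combines their variational inequalities into
  \<open>\<Delta>g \<bullet> \<Delta>x \<le> \<parallel>\<Delta>g\<parallel> * \<parallel>\<Delta>v\<parallel> / \<omega>\<close> for the difference \<open>\<Delta>g\<close> of the gradients, and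
  cocoercivity of the gradient together with strong monotonicity yields the factor
  \<open>sqrt (\<beta> / \<alpha>)\<close>. The estimate is local in time and extends to all times by subdivision
  (\<open>xopt_lipschitz\<close>). Since \<open>\<alpha> \<le> \<beta>\<close>, this speed is at most the number \<open>\<alpha> * r\<close> of the theorem.

  Normal vectors at a feasible point do not point towards the optimizer, so the flow approaches a
  frozen optimizer at rate \<open>\<alpha>\<close>, and the tracking error changes at rate at most
  \<open>speed - \<alpha> * error\<close>. The optimizer need not be differentiable, so this is stated for increments
  around a time where the solution is differentiable (\<open>tracking_error_decreases_locally\<close>) and
  integrated with a monotonicity principle for absolutely continuous functions that is also stated for
  increments (\<open>absolutely_continuous_on_nonincreasing\<close>).

  Solutions are limits of Moreau's catching-up scheme, which alternates explicit gradient steps and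
  projections onto the next feasible set. The iterates satisfy, between any two nodes, a linear
  variational inequality whose error is quadratic in the elapsed time (\<open>catch_up_variational\<close>).
  This inequality survives pointwise limits, and such limits exist by Tychonoff's theorem without any
  estimate of the convergence. The limit is locally Lipschitz, hence differentiable almost everywhere
  (\<open>lipschitz_differentiable_ae\<close>), and dividing the inequality by the elapsed time gives the
  differential inclusion at each point of differentiability.
\<close>

section \<open>Lipschitz functions of one real variable are differentiable almost everywhere\<close>

text \<open>
  The image of Lebesgue measure under the inverse of \<open>F\<close> is the Stieltjes measure of \<open>F\<close>. It vanishes
  on Lebesgue null sets because \<open>F\<close>, being Lipschitz, maps null sets to null sets; so it has a
  Radon-Nikodym density.
\<close>
lemma bilipschitz_increasing_has_density:
  fixes F :: "real \<Rightarrow> real"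
  assumes low: "\<And>x y. x \<le> y \<Longrightarrow> y - x \<le> F y - F x"
    and up: "\<And>x y. x \<le> y \<Longrightarrow> F y - F x \<le> K * (y - x)"
  obtains g :: "real \<Rightarrow> real" where "\<And>a b. a \<le> b \<Longrightarrow> (g has_integral (F b - F a)) {a..b}"
proof -
  have mono: "F x < F y" if "x < y" for x y
    using low[of x y] that by linarith
  have mono_le: "F x \<le> F y \<longleftrightarrow> x \<le> y" for x y
    using mono by (metis linorder_not_le order.order_iff_strict)
  have inj: "inj F"
    by (metis injI linorder_neqE mono order_less_irrefl)
  have Kdist: "dist (F x) (F y) \<le> K * dist x y" for x y
    using up[of x y] up[of y x] low[of x y] low[of y x] unfolding dist_real_def
    by (cases "x \<le> y") (auto simp: abs_if)
  have "K \<ge> 0" using low[of 0 1] up[of 0 1] by simp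
  then have lip: "K-lipschitz_on UNIV F"
    using Kdist by (intro lipschitz_onI) auto
  then have contF: "continuous_on UNIV F"
    by (rule lipschitz_on_continuous_on)
  have surj: "\<exists>x. F x = y" for y
  proof -
    define r where "r = \<bar>y - F 0\<bar>"
    have "F (- r) \<le> y" "y \<le> F r"
      using low[of "-r" 0] low[of 0 r] unfolding r_def by (auto simp: abs_if)
    then show ?thesis
      using IVT'[of F "-r" y r] continuous_on_subset[OF contF] unfolding r_def by auto
  qed
  define G where "G = inv F"
  have FG: "F (G y) = y" for y
    unfolding G_def by (metis surj f_inv_into_f rangeI)
  have GF: "G (F x) = x" for x
    unfolding G_def using inj by simp
  have "dist (G x) (G y) \<le> 1 * dist x y" for x y
    using low[of "G x" "G y"] low[of "G y" "G x"] unfolding dist_real_def FG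
    by (cases "G x \<le> G y") (auto simp: abs_if)
  then have "1-lipschitz_on UNIV G"
    by (intro lipschitz_onI) auto
  then have measG[measurable]: "G \<in> borel_measurable borel"
    by (intro borel_measurable_continuous_onI lipschitz_on_continuous_on)
  define N where "N = distr lborel borel G"
  have setsN: "sets N = sets lborel" by (simp add: N_def)
  have vimage: "G -` A = F ` A" for A
    using FG GF by (auto simp: image_iff) metis
  have emN: "emeasure N A = emeasure lborel (F ` A)" if "A \<in> sets borel" for A
    using that unfolding N_def by (subst emeasure_distr) (auto simp: vimage)
  have "absolutely_continuous lborel N"
    unfolding absolutely_continuous_def
  proof
    fix A :: "real set" assume A: "A \<in> null_sets lborel"
    then have Ab: "A \<in> sets borel" by auto
    have "negligible A"
      using A negligible_iff_null_sets null_sets_completionI by blast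
    then have "negligible (F ` A)"
      by (rule negligible_locally_Lipschitz_image[rotated])
         (use Kdist in \<open>auto simp: dist_norm intro!: exI[of _ UNIV]\<close>)
    moreover have "F ` A \<in> sets borel"
      using measurable_sets[OF measG Ab] by (simp add: vimage)
    ultimately have "emeasure lborel (F ` A) = 0"
      using emeasure_completion[of "F ` A" lborel]
      by (simp add: negligible_iff_null_sets null_sets_def sets_completionI_sets)
    then show "A \<in> null_sets N"
      using emN[OF Ab] Ab setsN by (auto simp: null_sets_def)
  qed
  then obtain d where d[measurable]: "d \<in> borel_measurable lborel" and dN: "density lborel d = N"
    using sigma_finite_measure.Radon_Nikodym[OF sigma_finite_lborel _ setsN] by blast
  define g where "g x = enn2real (d x)" for x
  have [measurable]: "g \<in> borel_measurable borel"
    using d unfolding g_def by measurable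
  have "(g has_integral (F b - F a)) {a..b}" if ab: "a \<le> b" for a b
  proof -
    have "F ` {a..b} = {F a..F b}"
    proof (intro equalityI subsetI)
      fix y assume "y \<in> {F a..F b}"
      then have "G y \<in> {a..b}" using mono_le[of a "G y"] mono_le[of "G y" b] by (auto simp: FG)
      then show "y \<in> F ` {a..b}" using FG by (metis image_eqI)
    qed (auto simp: mono_le)
    moreover have "(\<integral>\<^sup>+x. d x * indicator {a..b} x \<partial>lborel) = emeasure N {a..b}"
      unfolding dN[symmetric] by (subst emeasure_density) auto
    ultimately have int: "(\<integral>\<^sup>+x. d x * indicator {a..b} x \<partial>lborel) = ennreal (F b - F a)"
      using emN[of "{a..b}"] ab mono_le by simp
    have "AE x in lborel. d x * indicator {a..b} x \<noteq> \<infinity>"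
      by (rule nn_integral_noteq_infinite) (simp_all add: int)
    then have "AE x in lborel. d x * indicator {a..b} x = ennreal (g x * indicator {a..b} x)"
    proof eventually_elim
      case (elim x)
      then show ?case
        by (auto simp: g_def indicator_def ennreal_enn2real_if)
    qed
    then have "(\<integral>\<^sup>+x. ennreal (g x * indicator {a..b} x) \<partial>lborel) = ennreal (F b - F a)"
      unfolding int[symmetric] by (rule nn_integral_cong_AE[symmetric])
    then have "((\<lambda>x. g x * indicator {a..b} x) has_integral (F b - F a)) UNIV"
      using ab mono_le[of a b] by (intro nn_integral_has_integral) (auto simp: g_def)
    moreover have "(\<lambda>x. g x * indicator {a..b} x) = (\<lambda>x. if x \<in> {a..b} then g x else 0)"
      by (auto simp: indicator_def)
    ultimately show ?thesis
      by (simp only: has_integral_restrict_UNIV)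
  qed
  then show ?thesis using that by blast
qed

text \<open>
  The differentiation theorem for integrals controls averages over intervals to the right of a point;
  applied to \<open>g\<close> and to its reflection it controls both one-sided difference quotients, with the same
  limit.
\<close>
lemma antiderivative_has_derivative_ae:
  fixes F g :: "real \<Rightarrow> real"
  assumes int: "\<And>a b. a \<le> b \<Longrightarrow> (g has_integral (F b - F a)) {a..b}"
  obtains N where "negligible N" "\<And>x. x \<notin> N \<Longrightarrow> (F has_real_derivative g x) (at x)"
proof -
  have g_int: "g integrable_on cbox a b" for a b
    using int[of a b] by (cases "a \<le> b") auto
  have int': "((\<lambda>x. g (- x)) has_integral (F (- a) - F (- b))) {a..b}" if "a \<le> b" for a b
    using has_integral_reflect_real[where f = g and a = "-b" and b = "-a"] int[of "-b" "-a"] that by simp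
  then have g_int': "(\<lambda>x. g (- x)) integrable_on cbox a b" for a b
    by (cases "a \<le> b") auto
  obtain N1 where N1: "negligible N1" and right: "\<And>x e. \<lbrakk>x \<notin> N1; 0 < e\<rbrakk> \<Longrightarrow>
      \<exists>d>0. \<forall>h. 0 < h \<and> h < d \<longrightarrow> norm (integral (cbox x (x + h *\<^sub>R One)) g /\<^sub>R h ^ DIM(real) - g x) < e"
    using integrable_ccontinuous_explicit[of g] g_int by metis
  obtain N2 where N2: "negligible N2" and left: "\<And>x e. \<lbrakk>x \<notin> N2; 0 < e\<rbrakk> \<Longrightarrow>
      \<exists>d>0. \<forall>h. 0 < h \<and> h < d \<longrightarrow>
        norm (integral (cbox x (x + h *\<^sub>R One)) (\<lambda>x. g (- x)) /\<^sub>R h ^ DIM(real) - g (- x)) < e"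
    using integrable_ccontinuous_explicit[of "\<lambda>x. g (- x)"] g_int' by metis
  have "negligible (uminus ` N2)"
  proof (rule negligible_locally_Lipschitz_image[OF _ N2])
    fix x :: real
    show "\<exists>T B. open T \<and> x \<in> T \<and> (\<forall>y\<in>N2 \<inter> T. norm (- y - - x) \<le> B * norm (y - x))"
      by (intro exI[of _ UNIV] exI[of _ 1]) (auto simp: norm_minus_commute)
  qed simp
  then have "negligible (N1 \<union> uminus ` N2)"
    using N1 by (rule negligible_Un[rotated])
  moreover have "(F has_real_derivative g x) (at x)" if x: "x \<notin> N1 \<union> uminus ` N2" for x
  proof -
    have xx: "- x \<notin> N2" using x by force
    have "((\<lambda>h. (F (x + h) - F x) / h) \<longlongrightarrow> g x) (at 0)"
    proof (rule LIM_I)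
      fix e :: real assume e: "0 < e"
      obtain d1 where d1: "d1 > 0" and r1: "\<And>h. 0 < h \<Longrightarrow> h < d1 \<Longrightarrow>
          norm (integral (cbox x (x + h *\<^sub>R One)) g /\<^sub>R h ^ DIM(real) - g x) < e"
        using right[of x e] x e by blast
      obtain d2 where d2: "d2 > 0" and r2: "\<And>h. 0 < h \<Longrightarrow> h < d2 \<Longrightarrow>
          norm (integral (cbox (-x) (-x + h *\<^sub>R One)) (\<lambda>x. g (- x)) /\<^sub>R h ^ DIM(real) - g (- (- x))) < e"
        using left[of "-x" e] xx e by blast
      have "norm ((F (x + h) - F x) / h - g x) < e" if "h \<noteq> 0" "norm h < min d1 d2" for h
      proof (cases "h > 0")
        case True
        have "integral {x..x+h} g = F (x + h) - F x" using int[of x "x+h"] True by (simp add: integral_unique)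
        then show ?thesis using r1[of h] True that by (simp add: divide_inverse mult.commute)
      next
        case False
        define k where "k = - h"
        have k: "k > 0" "h = - k" using False that k_def by auto
        have "integral {-x..-x+k} (\<lambda>x. g (-x)) = F x - F (x - k)"
          using int'[of "-x" "-x+k"] k by (simp add: integral_unique)
        then have "(F (x + h) - F x) / h = integral {-x..-x+k} (\<lambda>x. g (-x)) / k"
          by (simp add: k diff_divide_distrib)
        then show ?thesis using r2[of k] k that by (simp add: divide_inverse mult.commute)
      qed
      then show "\<exists>s>0. \<forall>h. h \<noteq> 0 \<and> norm (h - 0) < s \<longrightarrow> norm ((F (x + h) - F x) / h - g x) < e"
        using d1 d2 by (intro exI[of _ "min d1 d2"]) auto
    qed
    then show "(F has_real_derivative g x) (at x)"
      by (simp add: DERIV_def)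
  qed
  ultimately show ?thesis using that by blast
qed

lemma lipschitz_real_differentiable_ae:
  fixes F :: "real \<Rightarrow> real"
  assumes lip: "L-lipschitz_on UNIV F"
  obtains N where "negligible N" "\<And>x. x \<notin> N \<Longrightarrow> F differentiable at x"
proof -
  have L: "\<bar>F y - F x\<bar> \<le> L * (y - x)" if "x \<le> y" for x y
    using lipschitz_onD[OF lip, of y x] that by (simp add: dist_real_def)
  \<comment> \<open>Adding this linear function makes a Lipschitz function increase with slopes in \<open>{1..2 * L + 1}\<close>.\<close>
  define G where "G x = F x + (L + 1) * x" for x
  obtain g where "\<And>a b. a \<le> b \<Longrightarrow> (g has_integral (G b - G a)) {a..b}"
  proof (rule bilipschitz_increasing_has_density[of G "2 * L + 1"])
    show "y - x \<le> G y - G x" "G y - G x \<le> (2 * L + 1) * (y - x)" if "x \<le> y" for x y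
      using L[OF that] by (auto simp: G_def abs_if algebra_simps split: if_splits)
  qed blast
  then obtain N where N: "negligible N" "\<And>x. x \<notin> N \<Longrightarrow> (G has_real_derivative g x) (at x)"
    using antiderivative_has_derivative_ae[of g G] by blast
  have "F differentiable at x" if "x \<notin> N" for x
  proof -
    have "((\<lambda>x. G x - (L + 1) * x) has_real_derivative g x - (L + 1)) (at x)"
      using N(2)[OF that] by (auto intro!: derivative_eq_intros)
    then show ?thesis
      by (auto simp: G_def real_differentiable_def)
  qed
  then show ?thesis using N that by blast
qed

text \<open>
  Rademacher's theorem in dimension one, applied to each coordinate of the extension of \<open>x\<close> that is
  constant outside the interval.
\<close>
lemma lipschitz_differentiable_ae:
  fixes x :: "real \<Rightarrow> 'a::euclidean_space"
  assumes lip: "L-lipschitz_on {a..b} x"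
  obtains N where "negligible N" "\<And>t. t \<in> {a<..<b} - N \<Longrightarrow> x differentiable at t"
proof (cases "a \<le> b")
  case False
  then show ?thesis using that[of "{}"] by auto
next
  case ab: True
  define cl where "cl t = max a (min t b)" for t
  have cl: "cl t \<in> {a..b}" for t using ab by (auto simp: cl_def)
  have cl1: "dist (cl s) (cl t) \<le> dist s t" for s t
    by (auto simp: cl_def dist_real_def)
  have L0: "L \<ge> 0" using lip by (rule lipschitz_on_nonneg)
  have "L-lipschitz_on UNIV (\<lambda>t. x (cl t) \<bullet> i)" if "i \<in> Basis" for i
  proof (intro lipschitz_onI L0)
    fix s t
    have "dist (x (cl s) \<bullet> i) (x (cl t) \<bullet> i) \<le> dist (x (cl s)) (x (cl t))"
      using that by (metis dist_norm inner_diff_left dist_real_def Basis_le_norm)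
    also have "\<dots> \<le> L * dist (cl s) (cl t)"
      using lipschitz_onD[OF lip] cl by blast
    also have "\<dots> \<le> L * dist s t"
      using cl1 L0 by (rule mult_left_mono)
    finally show "dist (x (cl s) \<bullet> i) (x (cl t) \<bullet> i) \<le> L * dist s t" .
  qed
  then have "\<exists>N. negligible N \<and> (\<forall>t. t \<notin> N \<longrightarrow> (\<lambda>t. x (cl t) \<bullet> i) differentiable at t)" if "i \<in> Basis" for i
    using lipschitz_real_differentiable_ae that by metis
  then obtain N where N: "\<And>i. i \<in> Basis \<Longrightarrow> negligible (N i)"
    "\<And>i t. i \<in> Basis \<Longrightarrow> t \<notin> N i \<Longrightarrow> (\<lambda>t. x (cl t) \<bullet> i) differentiable at t"
    by metis
  have "negligible (\<Union>i\<in>Basis. N i)"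
    using N(1) by (intro negligible_Union) auto
  moreover have "x differentiable at t" if t: "t \<in> {a<..<b} - (\<Union>i\<in>Basis. N i)" for t
  proof -
    have "(\<lambda>t. x (cl t)) differentiable at t"
      using N(2) t differentiable_componentwise_within[of "\<lambda>t. x (cl t)" t UNIV] by auto
    then obtain D where "((\<lambda>t. x (cl t)) has_derivative D) (at t)"
      by (auto simp: differentiable_def)
    then have "(x has_derivative D) (at t)"
      by (rule has_derivative_transform_within_open[of _ _ _ UNIV "{a<..<b}"])
         (use t in \<open>auto simp: cl_def\<close>)
    then show ?thesis by (auto simp: differentiable_def)
  qed
  ultimately show ?thesis using that by blast
qed

section \<open>Monotonicity of absolutely continuous functions\<close>

lemma derivative_straddle:
  fixes g :: "real \<Rightarrow> real"
  assumes "(g has_real_derivative D) (at t within S)" and "e > 0"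
  shows "\<exists>d>0. \<forall>u\<in>S. \<forall>v\<in>S. u \<le> t \<and> t \<le> v \<and> v - u < d \<longrightarrow> g v - g u \<le> (D + e) * (v - u)"
proof -
  obtain d where d: "d > 0" and lin: "\<And>y. y \<in> S \<Longrightarrow> \<bar>y - t\<bar> < d \<Longrightarrow> \<bar>g y - g t - D * (y - t)\<bar> \<le> e * \<bar>y - t\<bar>"
    using assms unfolding has_field_derivative_def has_derivative_within_alt by auto
  have "g v - g u \<le> (D + e) * (v - u)" if "u \<in> S" "v \<in> S" "u \<le> t" "t \<le> v" "v - u < d" for u v
  proof -
    have "g v - g t \<le> D * (v - t) + e * (v - t)" "g t - g u \<le> D * (t - u) + e * (t - u)"
      using lin[of v] lin[of u] that by (auto simp: abs_le_iff algebra_simps)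
    then show ?thesis by (simp add: algebra_simps)
  qed
  then show ?thesis using d by blast
qed

lemma division_measure_eq_sum_lengths:
  fixes D :: "real set set"
  assumes D: "D division_of \<Union>D"
  shows "\<Union>D \<in> lmeasurable" "measure lebesgue (\<Union>D) = (\<Sum>K\<in>D. Sup K - Inf K)"
proof -
  have K: "\<exists>a b. a \<le> b \<and> K = {a..b}" if "K \<in> D" for K
    using division_ofD(3,4)[OF D that] by (metis atLeastatMost_empty_iff box_real(2) linorder_not_le)
  have fin: "finite D" using D by blast
  show meas: "\<Union>D \<in> lmeasurable"
    using K by (intro fmeasurable.finite_Union fin) (metis lmeasurable_interval(1) subsetI)
  have "((\<lambda>_. 1) has_integral (\<Sum>K\<in>D. Sup K - Inf K)) (\<Union>D)"
  proof (rule has_integral_combine_division[OF D])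
    fix K assume "K \<in> D"
    then obtain a b where "a \<le> b" "K = {a..b}" using K by blast
    then show "((\<lambda>_. 1::real) has_integral (Sup K - Inf K)) K"
      using has_integral_const_real[of "1::real" a b] by simp
  qed
  then show "measure lebesgue (\<Union>D) = (\<Sum>K\<in>D. Sup K - Inf K)"
    unfolding lmeasure_integral[OF meas] by (rule integral_unique)
qed

text \<open>
  In a sufficiently fine tagged division the intervals with tag outside \<open>N\<close> contribute at most
  \<open>e * (b - a)\<close> by the local hypothesis, and those with tag in \<open>N\<close> contribute at most \<open>e\<close> by absolute
  continuity, because they lie in an open set of small measure. The local hypothesis bounds increments
  across \<open>t\<close> from above, which makes sense also where \<open>g\<close> is not differentiable.
\<close>
lemma absolutely_continuous_on_nonincreasing:
  fixes g :: "real \<Rightarrow> real"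
  assumes ac: "absolutely_continuous_on {a..b} g" and N: "negligible N" and ab: "a \<le> b"
    and loc: "\<And>t e. t \<in> {a..b} - N \<Longrightarrow> e > 0 \<Longrightarrow>
      \<exists>d>0. \<forall>u\<in>{a..b}. \<forall>v\<in>{a..b}. u \<le> t \<and> t \<le> v \<and> v - u < d \<longrightarrow> g v - g u \<le> e * (v - u)"
  shows "g b \<le> g a"
proof -
  have "g b - g a \<le> e * (b - a + 1)" if e: "e > 0" for e
  proof -
    obtain \<delta> where \<delta>: "\<delta> > 0" and ac\<delta>: "\<And>D. D division_of (\<Union>D) \<Longrightarrow> \<Union>D \<subseteq> {a..b} \<Longrightarrow>
        (\<Sum>K\<in>D. Sup K - Inf K) < \<delta> \<Longrightarrow> (\<Sum>K\<in>D. norm (g (Sup K) - g (Inf K))) < e"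
      using ac e unfolding absolutely_continuous_on_def by meson
    obtain T where T: "open T" "N \<subseteq> T" "T - N \<in> lmeasurable" "emeasure lebesgue (T - N) < ennreal \<delta>"
      using sets_lebesgue_outer_open[OF negligible_imp_sets[OF N] \<delta>] by blast
    have eT: "emeasure lebesgue T < ennreal \<delta>"
      using emeasure_Diff_null_set[of N lebesgue T] T(1,4) N
      by (simp add: negligible_iff_null_sets sets_completionI_sets del: emeasure_completion)
    have Tm: "T \<in> lmeasurable"
      using T(1) order_less_trans[OF eT ennreal_less_top]
      by (intro fmeasurableI) (simp_all add: sets_completionI_sets)
    have mT: "measure lebesgue T < \<delta>"
      using eT \<delta> unfolding emeasure_eq_measure2[OF Tm] by (simp add: ennreal_less_iff)
    obtain d where d: "\<And>t. t \<in> {a..b} - N \<Longrightarrow> d t > 0"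
      "\<And>t u v. t \<in> {a..b} - N \<Longrightarrow> u \<in> {a..b} \<Longrightarrow> v \<in> {a..b} \<Longrightarrow> u \<le> t \<Longrightarrow> t \<le> v \<Longrightarrow> v - u < d t \<Longrightarrow>
         g v - g u \<le> e * (v - u)"
      using loc[OF _ e] by metis
    \<comment> \<open>The radius is halved because an interval inside the ball has length below twice the radius.\<close>
    define \<gamma> where "\<gamma> t = (if t \<in> N then T else if t \<in> {a..b} then ball t (d t / 2) else UNIV)" for t
    have "gauge \<gamma>"
      unfolding gauge_def \<gamma>_def using T d(1) by auto
    then obtain p where p: "p tagged_division_of {a..b}" and fine: "\<gamma> fine p"
      by (rule fine_division_exists_real)
    have finp: "finite p" using p by blast
    have pK: "\<exists>u v. u \<le> t \<and> t \<le> v \<and> K = {u..v} \<and> u \<in> {a..b} \<and> v \<in> {a..b} \<and> K \<subseteq> \<gamma> t" if tK: "(t, K) \<in> p" for t K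
    proof -
      obtain u v where "K = cbox u v" using tagged_division_ofD(4)[OF p tK] by blast
      moreover have "t \<in> K" "K \<subseteq> {a..b}" using tagged_division_ofD(2,3)[OF p tK] by auto
      ultimately show ?thesis using fine tK unfolding fine_def by (intro exI[of _ u] exI[of _ v]) auto
    qed
    define p2 where "p2 = {(t, K) \<in> p. t \<in> N}"
    have p2sub: "p2 \<subseteq> p" by (auto simp: p2_def)
    have p2: "p2 tagged_partial_division_of {a..b}"
      using tagged_partial_division_subset[OF _ p2sub] p unfolding tagged_division_of_def by blast
    define D where "D = snd ` p2"
    have D: "D division_of \<Union>D"
      unfolding D_def by (rule partial_division_of_tagged_division[OF p2])
    have "\<Union>D \<subseteq> T"
      using pK unfolding D_def p2_def \<gamma>_def by fastforce
    moreover have "\<Union>D \<subseteq> {a..b}"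
      using pK unfolding D_def p2_def by fastforce
    moreover note division_measure_eq_sum_lengths[OF D] 
    ultimately have Dsum: "(\<Sum>K\<in>D. norm (g (Sup K) - g (Inf K))) < e"
      using measure_mono_fmeasurable[of "\<Union>D" T lebesgue] Tm mT
      by (intro ac\<delta>[OF D]) (auto simp: fmeasurableD)
    \<comment> \<open>\<open>Sup {}\<close> and \<open>Inf {}\<close> are unspecified, so the summand is set to 0 on the empty interval.\<close>
    define h where "h K = (if K = {} then 0 else norm (g (Sup K) - g (Inf K)))" for K :: "real set"
    have "(\<Sum>(t, K)\<in>p2. g (Sup K) - g (Inf K)) \<le> (\<Sum>(t, K)\<in>p2. h K)"
      using pK p2sub by (intro sum_mono) (fastforce simp: h_def)
    also have "\<dots> = sum h (snd ` p2)"
    proof (rule sum.over_tagged_division_lemma[OF tagged_partial_division_of_Union_self[OF p2]])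
      show "h (cbox u v) = 0" if "box u v = {}" for u v
        using that by (cases "u = v") (auto simp: h_def)
    qed
    also have "\<dots> \<le> (\<Sum>K\<in>D. norm (g (Sup K) - g (Inf K)))"
      unfolding D_def by (intro sum_mono) (auto simp: h_def)
    finally have bad: "(\<Sum>(t, K)\<in>p2. g (Sup K) - g (Inf K)) \<le> e" using Dsum by simp
    have "(\<Sum>(t, K)\<in>p - p2. g (Sup K) - g (Inf K)) \<le> (\<Sum>(t, K)\<in>p - p2. e * (Sup K - Inf K))"
    proof (intro sum_mono, clarify)
      fix t K assume tK: "(t, K) \<in> p" "(t, K) \<notin> p2"
      obtain u v where K: "u \<le> t" "t \<le> v" "K = {u..v}" "u \<in> {a..b}" "v \<in> {a..b}" "K \<subseteq> \<gamma> t"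
        using pK[OF tK(1)] by blast
      have t: "t \<in> {a..b} - N" using tK K by (auto simp: p2_def)
      then have "u \<in> ball t (d t / 2)" "v \<in> ball t (d t / 2)"
        using K by (auto simp: \<gamma>_def subset_iff)
      then have "v - u < d t" using K(1,2) by (simp add: dist_real_def)
      then show "g (Sup K) - g (Inf K) \<le> e * (Sup K - Inf K)"
        using d(2)[OF t K(4,5,1,2)] K by simp
    qed
    also have "\<dots> \<le> (\<Sum>(t, K)\<in>p. e * (Sup K - Inf K))"
      using pK e by (intro sum_mono2 finp) fastforce+
    also have "\<dots> = e * (\<Sum>(t, K)\<in>p. Sup K - Inf K)"
      by (simp add: sum_distrib_left case_prod_unfold)
    also have "\<dots> = e * (b - a)"
      using additive_tagged_division_1[OF ab p, of "\<lambda>x. x"] by simp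
    finally have "(\<Sum>(t, K)\<in>p. g (Sup K) - g (Inf K)) \<le> e * (b - a) + e"
      using bad sum.subset_diff[OF p2sub finp, of "\<lambda>(t, K). g (Sup K) - g (Inf K)"] by simp
    then show ?thesis
      using additive_tagged_division_1[OF ab p, of g] by (simp add: algebra_simps)
  qed
  note small = this
  have "g b \<le> g a + e" if "e > 0" for e
    using small[of "e / (b - a + 1)"] that ab by simp
  then show ?thesis by (rule field_le_epsilon)
qed

lemma absolutely_continuous_on_dominated:
  fixes x :: "real \<Rightarrow> 'a::real_normed_vector" and g :: "real \<Rightarrow> 'b::real_normed_vector"
  assumes ac: "absolutely_continuous_on S x" and "C \<ge> 0"
    and dom: "\<And>s t. s \<in> S \<Longrightarrow> t \<in> S \<Longrightarrow> s \<le> t \<Longrightarrow> norm (g t - g s) \<le> C * (norm (x t - x s) + (t - s))"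
  shows "absolutely_continuous_on S g"
  unfolding absolutely_continuous_on_def
proof (intro allI impI)
  fix e :: real assume e: "e > 0"
  define e' where "e' = e / (2 * (C + 1))"
  have e': "e' > 0" using e \<open>C \<ge> 0\<close> by (simp add: e'_def)
  obtain d where d: "d > 0" and ac': "\<And>D. D division_of (\<Union>D) \<Longrightarrow> \<Union>D \<subseteq> S \<Longrightarrow>
        (\<Sum>K\<in>D. Sup K - Inf K) < d \<Longrightarrow> (\<Sum>K\<in>D. norm (x (Sup K) - x (Inf K))) < e'"
    using ac e' unfolding absolutely_continuous_on_def by meson
  have "(\<Sum>K\<in>D. norm (g (Sup K) - g (Inf K))) < e"
    if D: "D division_of \<Union>D" "\<Union>D \<subseteq> S" "(\<Sum>K\<in>D. Sup K - Inf K) < min d e'" for D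
  proof -
    have "(\<Sum>K\<in>D. norm (g (Sup K) - g (Inf K)))
        \<le> (\<Sum>K\<in>D. C * (norm (x (Sup K) - x (Inf K)) + (Sup K - Inf K)))"
    proof (rule sum_mono)
      fix K assume KD: "K \<in> D"
      then obtain a b where "a \<le> b" "K = {a..b}"
        using division_ofD(3,4)[OF D(1)] by (metis atLeastatMost_empty_iff box_real(2) linorder_not_le)
      moreover have "K \<subseteq> S" using D(2) KD by blast
      ultimately have "a \<le> b" "K = {a..b}" "a \<in> S" "b \<in> S" by auto
      then show "norm (g (Sup K) - g (Inf K)) \<le> C * (norm (x (Sup K) - x (Inf K)) + (Sup K - Inf K))"
        using dom by simp
    qed
    also have "\<dots> = C * ((\<Sum>K\<in>D. norm (x (Sup K) - x (Inf K))) + (\<Sum>K\<in>D. Sup K - Inf K))"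
      by (simp only: sum_distrib_left[symmetric] sum.distrib)
    also have "\<dots> \<le> C * (e' + e')"
      using ac'[of D] D \<open>C \<ge> 0\<close> by (intro mult_left_mono add_mono) auto
    also have "\<dots> < e"
    proof -
      have "e = 2 * (C + 1) * e'" using \<open>C \<ge> 0\<close> by (simp add: e'_def)
      then show ?thesis using e' by (simp add: algebra_simps)
    qed
    finally show ?thesis .
  qed
  then show "\<exists>d>0. \<forall>D. D division_of \<Union>D \<and> \<Union>D \<subseteq> S \<and> (\<Sum>K\<in>D. Sup K - Inf K) < d \<longrightarrow>
      (\<Sum>K\<in>D. norm (g (Sup K) - g (Inf K))) < e"
    using d e' by (intro exI[of _ "min d e'"]) auto
qed

lemma lipschitz_imp_absolutely_continuous_on:
  fixes x :: "real \<Rightarrow> 'a::real_normed_vector"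
  assumes lip: "L-lipschitz_on S x"
  shows "absolutely_continuous_on S x"
proof (rule absolutely_continuous_on_dominated)
  show "absolutely_continuous_on S (\<lambda>_. 0::real)"
    by (auto simp: absolutely_continuous_on_def intro: exI[of _ 1])
  show "norm (x t - x s) \<le> L * (norm (0 - 0 :: real) + (t - s))" if "s \<in> S" "t \<in> S" "s \<le> t" for s t
    using lipschitz_onD[OF lip that(2,1)] that by (simp add: dist_norm)
qed (use lip lipschitz_on_nonneg in blast)

lemma absolutely_continuous_on_subset:
  "absolutely_continuous_on S x \<Longrightarrow> S' \<subseteq> S \<Longrightarrow> absolutely_continuous_on S' x"
  unfolding absolutely_continuous_on_def by (meson order_trans)

section \<open>Strongly convex functions with Lipschitz gradient\<close>

text \<open>
  The gradient is the Riesz representative of the derivative.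
\<close>
lemma GDERIV_gradient:
  fixes f :: "'a::euclidean_space \<Rightarrow> real"
  assumes "f differentiable at x"
  shows "GDERIV f x :> gradient f x"
proof -
  obtain f' where f': "(f has_derivative f') (at x)"
    using assms by (auto simp: differentiable_def)
  interpret linear f' by (rule has_derivative_linear[OF f'])
  have "f' h = h \<bullet> (\<Sum>b\<in>Basis. f' b *\<^sub>R b)" for h
  proof -
    have "f' h = f' (\<Sum>b\<in>Basis. (h \<bullet> b) *\<^sub>R b)" by (simp add: euclidean_representation)
    then show ?thesis by (simp add: sum scale inner_sum_right mult.commute)
  qed
  then have "f' = (\<lambda>h. h \<bullet> (\<Sum>b\<in>Basis. f' b *\<^sub>R b))" by (rule ext)
  then have ex: "GDERIV f x :> (\<Sum>b\<in>Basis. f' b *\<^sub>R b)"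
    using f' by (simp add: gderiv_def)
  show ?thesis unfolding gradient_def
  proof (rule theI[where P = "\<lambda>g. GDERIV f x :> g", OF ex])
    fix g assume "GDERIV f x :> g"
    then have "(\<lambda>h. h \<bullet> g) = (\<lambda>h. h \<bullet> (\<Sum>b\<in>Basis. f' b *\<^sub>R b))"
      using ex unfolding gderiv_def by (rule has_derivative_unique)
    then show "g = (\<Sum>b\<in>Basis. f' b *\<^sub>R b)" by (metis vector_eq_ldot)
  qed
qed

lemma gradient_eqI: "GDERIV f x :> g \<Longrightarrow> gradient f x = (g :: 'a::euclidean_space)"
  unfolding gradient_def
proof (rule the_equality)
  fix g' assume "GDERIV f x :> g" "GDERIV f x :> g'"
  then have "(\<lambda>h. h \<bullet> g') = (\<lambda>h. h \<bullet> g)"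
    unfolding gderiv_def by (intro has_derivative_unique)
  then show "g' = g" by (metis vector_eq_ldot)
qed

lemma has_real_derivative_along_line:
  fixes f :: "'a::euclidean_space \<Rightarrow> real"
  assumes "f differentiable at (x + u *\<^sub>R d)"
  shows "((\<lambda>u. f (x + u *\<^sub>R d)) has_real_derivative gradient f (x + u *\<^sub>R d) \<bullet> d) (at u)"
proof -
  have "((\<lambda>u. x + u *\<^sub>R d) has_derivative (\<lambda>h. h *\<^sub>R d)) (at u)"
    by (auto intro!: derivative_eq_intros)
  moreover have "(f has_derivative (\<lambda>h. h \<bullet> gradient f (x + u *\<^sub>R d))) (at (x + u *\<^sub>R d))"
    using GDERIV_gradient[OF assms] by (simp add: gderiv_def)
  ultimately have "((\<lambda>u. f (x + u *\<^sub>R d)) has_derivative (\<lambda>h. (h *\<^sub>R d) \<bullet> gradient f (x + u *\<^sub>R d))) (at u)"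
    by (rule has_derivative_compose)
  then show ?thesis
    by (simp add: has_field_derivative_def inner_commute mult_commute_abs)
qed

lemma difference_quotient_at_right_0:
  fixes f :: "'a::euclidean_space \<Rightarrow> real"
  assumes "f differentiable at x"
  shows "((\<lambda>u. (f (x + u *\<^sub>R d) - f x) / u) \<longlongrightarrow> gradient f x \<bullet> d) (at_right 0)"
proof -
  have "((\<lambda>u. f (x + u *\<^sub>R d)) has_real_derivative gradient f x \<bullet> d) (at 0)"
    using has_real_derivative_along_line[of f x 0 d] assms by simp
  then have "((\<lambda>u. (f (x + u *\<^sub>R d) - f x) / u) \<longlongrightarrow> gradient f x \<bullet> d) (at 0)"
    by (simp add: DERIV_def)
  then show ?thesis by (rule filterlim_mono) (auto simp: at_le)
qed

lemma strongly_convex_above_tangent: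
  fixes f :: "'a::euclidean_space \<Rightarrow> real"
  assumes sc: "strongly_convex \<alpha> f" and diff: "f differentiable at x"
  shows "f x + gradient f x \<bullet> (y - x) + \<alpha> / 2 * (norm (y - x))\<^sup>2 \<le> f y"
proof -
  define d where "d = y - x"
  have limit: "((\<lambda>u. f y - f x - \<alpha> / 2 * (1 - u) * (norm d)\<^sup>2) \<longlongrightarrow> f y - f x - \<alpha> / 2 * (1 - 0) * (norm d)\<^sup>2) (at_right 0)"
    by (intro tendsto_intros)
  have bound: "\<forall>\<^sub>F u in at_right 0. (f (x + u *\<^sub>R d) - f x) / u \<le> f y - f x - \<alpha> / 2 * (1 - u) * (norm d)\<^sup>2"
  proof -
    have "(f (x + u *\<^sub>R d) - f x) / u \<le> f y - f x - \<alpha> / 2 * (1 - u) * (norm d)\<^sup>2" if u: "0 < u" "u < 1" for u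
    proof -
      have "f ((1 - u) *\<^sub>R x + u *\<^sub>R y) \<le> (1 - u) * f x + u * f y - \<alpha> / 2 * u * (1 - u) * (norm (x - y))\<^sup>2"
        using sc u unfolding strongly_convex_def by auto
      moreover have "(1 - u) *\<^sub>R x + u *\<^sub>R y = x + u *\<^sub>R d" by (simp add: d_def algebra_simps)
      ultimately have "f (x + u *\<^sub>R d) - f x \<le> u * (f y - f x - \<alpha> / 2 * (1 - u) * (norm d)\<^sup>2)"
        by (simp add: d_def norm_minus_commute algebra_simps)
      then show ?thesis using u by (simp add: pos_divide_le_eq mult.commute)
    qed
    then show ?thesis
      using eventually_at_right_real[of 0 1] by (auto elim: eventually_mono)
  qed
  have "gradient f x \<bullet> d \<le> f y - f x - \<alpha> / 2 * (1 - 0) * (norm d)\<^sup>2"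
    by (rule tendsto_le[OF trivial_limit_at_right_real limit difference_quotient_at_right_0[OF diff] bound])
  then show ?thesis by (simp add: d_def)
qed

lemma gradient_strongly_monotone:
  fixes f :: "'a::euclidean_space \<Rightarrow> real"
  assumes "strongly_convex \<alpha> f" and "\<And>x. f differentiable at x"
  shows "\<alpha> * (norm (x - y))\<^sup>2 \<le> (gradient f x - gradient f y) \<bullet> (x - y)"
  using strongly_convex_above_tangent[OF assms, of x y] strongly_convex_above_tangent[OF assms, of y x]
  by (simp add: norm_minus_commute algebra_simps)

lemma lipschitz_gradient_descent:
  fixes f :: "'a::euclidean_space \<Rightarrow> real"
  assumes diff: "\<And>x. f differentiable at x" and lip: "\<beta>-lipschitz_on UNIV (gradient f)"
  shows "f y \<le> f x + gradient f x \<bullet> (y - x) + \<beta> / 2 * (norm (y - x))\<^sup>2"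
proof -
  define d where "d = y - x"
  define g where "g u = f (x + u *\<^sub>R d) - u * (gradient f x \<bullet> d) - \<beta> / 2 * u\<^sup>2 * (norm d)\<^sup>2" for u
  have "g 1 \<le> g 0"
  proof (rule DERIV_nonpos_imp_nonincreasing[of 0 1 g])
    fix u :: real assume u: "0 \<le> u" "u \<le> 1"
    have "(g has_real_derivative gradient f (x + u *\<^sub>R d) \<bullet> d - gradient f x \<bullet> d - \<beta> * u * (norm d)\<^sup>2) (at u)"
      unfolding g_def
      by (auto intro!: derivative_eq_intros has_real_derivative_along_line diff)
    moreover have "gradient f (x + u *\<^sub>R d) \<bullet> d - gradient f x \<bullet> d \<le> \<beta> * u * (norm d)\<^sup>2"
    proof -
      have "(gradient f (x + u *\<^sub>R d) - gradient f x) \<bullet> d \<le> norm (gradient f (x + u *\<^sub>R d) - gradient f x) * norm d"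
        by (rule norm_cauchy_schwarz)
      also have "\<dots> \<le> \<beta> * norm (u *\<^sub>R d) * norm d"
        using lipschitz_onD[OF lip, of "x + u *\<^sub>R d" x] by (intro mult_right_mono) (auto simp: dist_norm)
      finally show ?thesis using u by (simp add: inner_diff_left power2_eq_square mult.assoc)
    qed
    ultimately show "\<exists>y. (g has_real_derivative y) (at u) \<and> y \<le> 0"
      by (intro exI conjI) (assumption, simp)
  qed simp
  then show ?thesis by (simp add: g_def d_def)
qed

text \<open>
  A single gradient step of length \<open>1 / \<beta>\<close> at \<open>y\<close> for the convex function
  \<open>\<lambda>z. f z - gradient f x \<bullet> z\<close>, whose minimum is at \<open>x\<close>, lowers its value by
  \<open>\<parallel>gradient f y - gradient f x\<parallel>\<^sup>2 / (2 * \<beta>)\<close>. Adding the resulting inequality to the one with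
  \<open>x\<close> and \<open>y\<close> exchanged gives the claim.
\<close>
lemma gradient_cocoercive:
  fixes f :: "'a::euclidean_space \<Rightarrow> real"
  assumes sc: "strongly_convex \<alpha> f" and diff: "\<And>x. f differentiable at x"
    and lip: "\<beta>-lipschitz_on UNIV (gradient f)" and "\<beta> > 0"
  shows "(norm (gradient f x - gradient f y))\<^sup>2 \<le> \<beta> * ((gradient f x - gradient f y) \<bullet> (x - y))"
proof -
  have gain: "f x + gradient f x \<bullet> (y - x) + (norm (gradient f y - gradient f x))\<^sup>2 / (2 * \<beta>) \<le> f y" for x y
  proof -
    define w where "w = gradient f y - gradient f x"
    define z where "z = y - w /\<^sub>R \<beta>"
    have \<alpha>: "\<alpha> > 0" using sc by (simp add: strongly_convex_def)
    have "f x + gradient f x \<bullet> (z - x) \<le> f z"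
      using strongly_convex_above_tangent[OF sc diff, of x z] \<alpha>
      by (smt (verit) divide_nonneg_nonneg mult_nonneg_nonneg zero_le_power2)
    also have "f z \<le> f y + gradient f y \<bullet> (z - y) + \<beta> / 2 * (norm (z - y))\<^sup>2"
      by (rule lipschitz_gradient_descent[OF diff lip])
    finally have "f x + gradient f x \<bullet> (z - x) - gradient f y \<bullet> (z - y) - \<beta> / 2 * (norm (z - y))\<^sup>2 \<le> f y"
      by simp
    moreover have "gradient f x \<bullet> (z - x) - gradient f y \<bullet> (z - y) = gradient f x \<bullet> (y - x) + (norm w)\<^sup>2 / \<beta>"
      by (simp add: z_def w_def power2_norm_eq_inner algebra_simps divide_inverse)
    moreover have "\<beta> / 2 * (norm (z - y))\<^sup>2 = (norm w)\<^sup>2 / (2 * \<beta>)"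
      using \<open>\<beta> > 0\<close> by (simp add: z_def power_mult_distrib power2_eq_square field_simps)
    moreover have "(norm w)\<^sup>2 / \<beta> - (norm w)\<^sup>2 / (2 * \<beta>) = (norm w)\<^sup>2 / (2 * \<beta>)"
      using \<open>\<beta> > 0\<close> by (simp add: field_simps)
    ultimately show ?thesis unfolding w_def by linarith
  qed
  have "(norm (gradient f x - gradient f y))\<^sup>2 / (2 * \<beta>) + (norm (gradient f x - gradient f y))\<^sup>2 / (2 * \<beta>)
      \<le> (gradient f x - gradient f y) \<bullet> (x - y)"
    using gain[of x y] gain[of y x] by (simp add: norm_minus_commute algebra_simps)
  then show ?thesis using \<open>\<beta> > 0\<close> by (simp add: field_simps)
qed

text \<open>
  Quadratic growth above a tangent bounds the sublevel set through any point of \<open>S\<close>, which reduces the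
  claim to a compact set.
\<close>
lemma strongly_convex_attains_min:
  fixes f :: "'a::euclidean_space \<Rightarrow> real"
  assumes sc: "strongly_convex \<alpha> f" and diff: "\<And>x. f differentiable at x"
    and S: "closed S" "S \<noteq> {}"
  shows "\<exists>x\<in>S. \<forall>y\<in>S. f x \<le> f y"
proof -
  obtain x0 where x0: "x0 \<in> S" using S by blast
  have \<alpha>: "\<alpha> > 0" using sc by (simp add: strongly_convex_def)
  have cont: "continuous_on A f" for A
    using diff by (meson continuous_at_imp_continuous_on differentiable_imp_continuous_within)
  define K where "K = S \<inter> {y. f y \<le> f x0}"
  have "norm (y - x0) \<le> 2 * norm (gradient f x0) / \<alpha>" if "y \<in> K" for y
  proof (cases "y = x0")
    case False
    have "\<alpha> / 2 * (norm (y - x0))\<^sup>2 \<le> - (gradient f x0 \<bullet> (y - x0))"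
      using strongly_convex_above_tangent[OF sc diff, of x0 y] that by (simp add: K_def)
    also have "\<dots> \<le> norm (gradient f x0) * norm (y - x0)"
      using Cauchy_Schwarz_ineq2[of "gradient f x0" "y - x0"] by linarith
    finally have "\<alpha> / 2 * norm (y - x0) \<le> norm (gradient f x0)"
      using False by (simp add: power2_eq_square)
    then show ?thesis using \<alpha> by (simp add: field_simps)
  qed (use \<alpha> in simp)
  then have "bounded K"
    by (intro boundedI[of K "norm x0 + 2 * norm (gradient f x0) / \<alpha>"])
       (metis add_left_mono norm_triangle_sub order_trans)
  moreover have "closed K"
    unfolding K_def using S(1) cont by (intro closed_Int closed_Collect_le continuous_intros) auto
  ultimately have "compact K" by (simp add: compact_eq_bounded_closed)
  moreover have "K \<noteq> {}" using x0 by (auto simp: K_def)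
  ultimately obtain x where "x \<in> K" "\<forall>y\<in>K. f x \<le> f y"
    using continuous_attains_inf cont by blast
  then have "x \<in> S" "f x \<le> f x0" "\<And>y. y \<in> S \<Longrightarrow> f y \<le> f x0 \<Longrightarrow> f x \<le> f y"
    by (auto simp: K_def)
  then have "f x \<le> f y" if "y \<in> S" for y
    using that by (cases "f y \<le> f x0") auto
  then show ?thesis using \<open>x \<in> S\<close> by blast
qed

lemma minimizer_variational_inequality:
  fixes f :: "'a::euclidean_space \<Rightarrow> real"
  assumes diff: "f differentiable at x" and "convex S" "x \<in> S" "y \<in> S"
    and min: "\<And>y. y \<in> S \<Longrightarrow> f x \<le> f y"
  shows "0 \<le> gradient f x \<bullet> (y - x)"
proof (rule tendsto_lowerbound[OF difference_quotient_at_right_0[OF diff]])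
  have "0 \<le> (f (x + u *\<^sub>R (y - x)) - f x) / u" if "0 < u" "u < 1" for u
  proof -
    have "x + u *\<^sub>R (y - x) = (1 - u) *\<^sub>R x + u *\<^sub>R y" by (simp add: algebra_simps)
    then have "x + u *\<^sub>R (y - x) \<in> S"
      using convexD[OF \<open>convex S\<close> \<open>x \<in> S\<close> \<open>y \<in> S\<close>, of "1 - u" u] that by simp
    then show ?thesis using min that by simp
  qed
  then show "\<forall>\<^sub>F u in at_right 0. 0 \<le> (f (x + u *\<^sub>R (y - x)) - f x) / u"
    using eventually_at_right_real[of 0 1] by (auto elim: eventually_mono)
qed simp

lemma translated_gradient:
  fixes f :: "'a::euclidean_space \<Rightarrow> real"
  assumes diff: "\<And>x. f differentiable at x"
  shows "(\<lambda>x. f (x - c)) differentiable at x" "gradient (\<lambda>x. f (x - c)) x = gradient f (x - c)"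
proof -
  have "(f has_derivative (\<lambda>h. h \<bullet> gradient f (x - c))) (at (x - c))"
    using GDERIV_gradient[OF diff] by (simp add: gderiv_def)
  moreover have "((\<lambda>x. x - c) has_derivative (\<lambda>h. h)) (at x)"
    by (auto intro!: derivative_eq_intros)
  ultimately have *: "((\<lambda>x. f (x - c)) has_derivative (\<lambda>h. h \<bullet> gradient f (x - c))) (at x)"
    by (rule has_derivative_compose[rotated])
  then show "(\<lambda>x. f (x - c)) differentiable at x" by (auto simp: differentiable_def)
  show "gradient (\<lambda>x. f (x - c)) x = gradient f (x - c)"
    using * by (intro gradient_eqI) (simp add: gderiv_def)
qed

lemma translated_strongly_convex:
  assumes "strongly_convex \<alpha> f"
  shows "strongly_convex \<alpha> (\<lambda>x. f (x - c))"
  unfolding strongly_convex_def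
proof (intro conjI allI ballI)
  fix x y :: 'a and u :: real assume "u \<in> {0..1}"
  then have "f ((1 - u) *\<^sub>R (x - c) + u *\<^sub>R (y - c))
        \<le> (1 - u) * f (x - c) + u * f (y - c) - \<alpha> / 2 * u * (1 - u) * (norm ((x - c) - (y - c)))\<^sup>2"
    using assms unfolding strongly_convex_def by blast
  moreover have "(1 - u) *\<^sub>R (x - c) + u *\<^sub>R (y - c) = (1 - u) *\<^sub>R x + u *\<^sub>R y - c"
    by (simp add: algebra_simps)
  ultimately show "f ((1 - u) *\<^sub>R x + u *\<^sub>R y - c)
        \<le> (1 - u) * f (x - c) + u * f (y - c) - \<alpha> / 2 * u * (1 - u) * (norm (x - y))\<^sup>2"
    by simp
qed (use assms in \<open>simp add: strongly_convex_def\<close>)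

lemma strongly_convex_unique_min:
  fixes f :: "'a::euclidean_space \<Rightarrow> real"
  assumes sc: "strongly_convex \<alpha> f" and diff: "\<And>x. f differentiable at x"
    and S: "closed S" "convex S" "S \<noteq> {}"
  shows "\<exists>!x. is_arg_min f (\<lambda>x. x \<in> S) x"
proof -
  obtain x where x: "x \<in> S" "\<forall>y\<in>S. f x \<le> f y"
    using strongly_convex_attains_min[OF sc diff S(1,3)] by blast
  show ?thesis
  proof (rule ex1I)
    show "is_arg_min f (\<lambda>x. x \<in> S) x" using x by (auto simp: is_arg_min_linorder)
    fix y assume y: "is_arg_min f (\<lambda>x. x \<in> S) y"
    have "f x + gradient f x \<bullet> (y - x) + \<alpha> / 2 * (norm (y - x))\<^sup>2 \<le> f y"
      by (rule strongly_convex_above_tangent[OF sc diff])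
    moreover have "0 \<le> gradient f x \<bullet> (y - x)"
      using minimizer_variational_inequality[OF diff S(2) x(1)] x y by (auto simp: is_arg_min_def)
    moreover have "f y \<le> f x" using y x(1) by (auto simp: is_arg_min_linorder)
    ultimately have "\<alpha> / 2 * (norm (y - x))\<^sup>2 \<le> 0" by linarith
    moreover have "\<alpha> > 0" using sc by (simp add: strongly_convex_def)
    ultimately show "y = x" by (simp add: mult_le_0_iff)
  qed
qed

section \<open>Polyhedra and their active constraints\<close>

lemma mem_feasible_iff: "x \<in> feasible U b \<longleftrightarrow> (\<forall>i. U $ i \<bullet> x \<le> b $ i)"
  by (simp add: feasible_def less_eq_vec_def matrix_vector_mul_component)

lemma mem_active_iff: "i \<in> active U b x \<longleftrightarrow> U $ i \<bullet> x = b $ i"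
  by (simp add: active_def matrix_vector_mul_component)

lemma closed_feasible: "closed (feasible U b)"
proof -
  have "feasible U b = (\<Inter>i. {x. U $ i \<bullet> x \<le> b $ i})" by (auto simp: mem_feasible_iff)
  then show ?thesis by (auto intro: closed_halfspace_le)
qed

lemma convex_feasible: "convex (feasible U b)"
proof -
  have "feasible U b = (\<Inter>i. {x. U $ i \<bullet> x \<le> b $ i})" by (auto simp: mem_feasible_iff)
  then show ?thesis by (auto intro: convex_halfspace_le convex_INT)
qed

lemma loewner_le_row_combination:
  fixes U :: "real^'n^'m"
  assumes "loewner_le_on I (scaled_identity (\<omega>\<^sup>2)) (times_transpose (row_submatrix U I))"
  shows "\<omega>\<^sup>2 * (\<Sum>i\<in>I. (z i)\<^sup>2) \<le> (norm (\<Sum>i\<in>I. z i *\<^sub>R U $ i))\<^sup>2"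
proof -
  have entry: "times_transpose (row_submatrix U I) i k = U $ i \<bullet> U $ k" if "i \<in> I" "k \<in> I" for i k
    using that by (simp add: times_transpose_def row_submatrix_def inner_vec_def)
  have "0 \<le> (\<Sum>i\<in>I. \<Sum>k\<in>I. z i * (times_transpose (row_submatrix U I) i k - scaled_identity (\<omega>\<^sup>2) i k) * z k)"
    using assms by (simp add: loewner_le_on_def psd_on_def)
  also have "\<dots> = (\<Sum>i\<in>I. \<Sum>k\<in>I. z i * z k * (U $ i \<bullet> U $ k)) - (\<Sum>i\<in>I. \<Sum>k\<in>I. if i = k then \<omega>\<^sup>2 * (z i)\<^sup>2 else 0)"
    unfolding sum_subtractf[symmetric]
    by (intro sum.cong refl) (auto simp: entry scaled_identity_def algebra_simps power2_eq_square)
  also have "(\<Sum>i\<in>I. \<Sum>k\<in>I. if i = k then \<omega>\<^sup>2 * (z i)\<^sup>2 else 0) = \<omega>\<^sup>2 * (\<Sum>i\<in>I. (z i)\<^sup>2)"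
    by (simp add: sum_distrib_left)
  also have "(\<Sum>i\<in>I. \<Sum>k\<in>I. z i * z k * (U $ i \<bullet> U $ k)) = (norm (\<Sum>i\<in>I. z i *\<^sub>R U $ i))\<^sup>2"
    unfolding power2_norm_eq_inner inner_sum_left inner_sum_right
    by (simp add: mult.assoc mult.left_commute sum_distrib_left inner_commute)
  finally show ?thesis by simp
qed

text \<open>
  The solution taken is the minimum norm one, \<open>d = V\<^sup>T z\<close> with \<open>V V\<^sup>T z = b\<close>, where \<open>V\<close> consists of
  the rows with index in \<open>I\<close>. The hypothesis makes the Gram matrix injective and bounds
  \<open>\<omega> * \<parallel>z\<parallel>\<close> by \<open>\<parallel>d\<parallel>\<close>; then
  \<open>\<parallel>d\<parallel>\<^sup>2 = z \<bullet> b \<le> \<parallel>d\<parallel> * \<parallel>b\<parallel> / \<omega>\<close>.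
\<close>
lemma bounded_right_inverse_of_rows:
  fixes U :: "real^'n^'m" and b :: "real^'m"
  assumes "\<omega> > 0"
    and low: "\<And>z. \<omega>\<^sup>2 * (\<Sum>i\<in>I. (z i)\<^sup>2) \<le> (norm (\<Sum>i\<in>I. z i *\<^sub>R U $ i))\<^sup>2"
  obtains d where "\<And>i. i \<in> I \<Longrightarrow> U $ i \<bullet> d = b $ i" "norm d \<le> norm b / \<omega>"
proof -
  define comb where "comb z = (\<Sum>i\<in>I. z $ i *\<^sub>R U $ i)" for z :: "real^'m"
  \<comment> \<open>The Gram matrix of the rows in \<open>I\<close>, extended by the identity to an endomorphism.\<close>
  define M where "M z = (\<chi> i. if i \<in> I then U $ i \<bullet> comb z else z $ i)" for z
  have comb_inner: "comb z \<bullet> comb z = (\<Sum>i\<in>I. z $ i * (U $ i \<bullet> comb z))" for z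
    by (subst comb_def) (simp add: inner_sum_left)
  have comb_linear: "linear comb"
    by (intro linearI) (simp_all add: comb_def algebra_simps sum.distrib scaleR_sum_right)
  have "linear M"
    by (intro linearI)
       (auto simp: M_def vec_eq_iff linear_add[OF comb_linear] linear_scale[OF comb_linear] inner_add_right)
  moreover have "inj M"
    unfolding linear_injective_0[OF \<open>linear M\<close>]
  proof (intro allI impI)
    fix z assume M0: "M z = 0"
    have "comb z \<bullet> comb z = (\<Sum>i\<in>I. z $ i * M z $ i)"
      unfolding comb_inner by (simp add: M_def)
    then have "comb z = 0" using M0 by simp
    then have "\<omega>\<^sup>2 * (\<Sum>i\<in>I. (z $ i)\<^sup>2) \<le> 0" using low[of "\<lambda>i. z $ i"] by (simp add: comb_def)
    then have "(\<Sum>i\<in>I. (z $ i)\<^sup>2) \<le> 0"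
      using \<open>\<omega> > 0\<close> by (simp add: mult_le_0_iff)
    then have "(\<Sum>i\<in>I. (z $ i)\<^sup>2) = 0" by (simp add: sum_nonneg order_antisym)
    then have "\<forall>i\<in>I. z $ i = 0" by (simp add: sum_nonneg_eq_0_iff)
    moreover have "z $ i = 0" if "i \<notin> I" for i
      using M0 that by (auto simp: M_def vec_eq_iff dest: spec[of _ i])
    ultimately show "z = 0" by (auto simp: vec_eq_iff)
  qed
  ultimately have "surj M" by (rule linear_inj_imp_surj)
  then obtain z where z: "M z = b" by (metis surjD)
  define d where "d = comb z"
  have d: "U $ i \<bullet> d = b $ i" if "i \<in> I" for i
    using z that by (auto simp: M_def d_def)
  define s where "s = sqrt (\<Sum>i\<in>I. (z $ i)\<^sup>2)"
  have s: "s\<^sup>2 = (\<Sum>i\<in>I. (z $ i)\<^sup>2)" "s \<ge> 0"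
    unfolding s_def by (auto intro: sum_nonneg)
  have "(\<omega> * s)\<^sup>2 \<le> (norm d)\<^sup>2"
    using low[of "\<lambda>i. z $ i"] by (simp add: d_def comb_def s(1) power_mult_distrib)
  then have sd: "\<omega> * s \<le> norm d" by (rule power2_le_imp_le) simp
  have "(norm d)\<^sup>2 = (\<Sum>i\<in>I. z $ i * b $ i)"
    using d by (simp add: power2_norm_eq_inner d_def comb_inner)
  also have "\<dots> \<le> L2_set (\<lambda>i. z $ i) I * L2_set (\<lambda>i. b $ i) I"
    by (rule order_trans[OF sum_mono L2_set_mult_ineq]) (simp add: abs_mult[symmetric])
  also have "\<dots> \<le> s * norm b"
  proof -
    have "(\<Sum>i\<in>I. (b $ i)\<^sup>2) \<le> (\<Sum>i\<in>UNIV. (b $ i)\<^sup>2)"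
      by (intro sum_mono2) auto
    then show ?thesis
      unfolding s_def L2_set_def norm_vec_def by (intro mult_mono) (auto intro: sum_nonneg)
  qed
  finally have "\<omega> * (norm d)\<^sup>2 \<le> (\<omega> * s) * norm b" using \<open>\<omega> > 0\<close> by simp
  also have "\<dots> \<le> norm d * norm b" using sd by (intro mult_right_mono) auto
  finally have "\<omega> * norm d \<le> norm b" by (cases "d = 0") (auto simp: power2_eq_square)
  then have "norm d \<le> norm b / \<omega>" using \<open>\<omega> > 0\<close> by (simp add: field_simps)
  then show ?thesis using d that by blast
qed

text \<open>
  Constraints that are not active leave room for a small step, so a direction that does not increase
  any active row stays feasible for a short time.
\<close>
lemma normal_to_feasible_imp_inner_nonpos:
  fixes U :: "real^'n^'m"
  assumes x: "x \<in> feasible U b" and normal: "\<And>y. y \<in> feasible U b \<Longrightarrow> p \<bullet> (y - x) \<le> 0"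
    and w: "\<And>i. i \<in> active U b x \<Longrightarrow> U $ i \<bullet> w \<le> 0"
  shows "p \<bullet> w \<le> 0"
proof -
  have "\<forall>\<^sub>F e in at_right 0. U $ i \<bullet> (x + e *\<^sub>R w) \<le> b $ i" for i
  proof (cases "i \<in> active U b x")
    case True
    have "\<forall>\<^sub>F e in at_right (0::real). e > 0" by (simp add: eventually_at_right_less)
    then show ?thesis
    proof eventually_elim
      case (elim e)
      then have "e * (U $ i \<bullet> w) \<le> 0" using w[OF True] by (simp add: mult_nonneg_nonpos)
      then show ?case using True by (simp add: mem_active_iff inner_add_right)
    qed
  next
    case False
    then have "U $ i \<bullet> (x + 0 *\<^sub>R w) < b $ i"
      using x by (auto simp: mem_feasible_iff mem_active_iff order.strict_iff_order)
    moreover have "((\<lambda>e. U $ i \<bullet> (x + e *\<^sub>R w)) \<longlongrightarrow> U $ i \<bullet> (x + 0 *\<^sub>R w)) (at_right 0)"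
      by (intro tendsto_intros)
    ultimately have "\<forall>\<^sub>F e in at_right 0. U $ i \<bullet> (x + e *\<^sub>R w) < b $ i"
      by (simp only: order_tendstoD)
    then show ?thesis by (auto elim: eventually_mono)
  qed
  then have "\<forall>\<^sub>F e in at_right 0. \<forall>i. U $ i \<bullet> (x + e *\<^sub>R w) \<le> b $ i"
    by (rule eventually_all_finite)
  moreover have "\<forall>\<^sub>F e in at_right (0::real). e > 0" by (simp add: eventually_at_right_less)
  ultimately have "\<forall>\<^sub>F e in at_right (0::real). p \<bullet> w \<le> 0"
  proof eventually_elim
    case (elim e)
    then have "p \<bullet> (x + e *\<^sub>R w - x) \<le> 0" by (intro normal) (simp add: mem_feasible_iff)
    then show ?case using elim by (simp add: mult_le_0_iff)
  qed
  then show ?thesis by simp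
qed

text \<open>
  Let \<open>y\<close> be the projection of \<open>x\<close> onto the other polyhedron. Moving \<open>x\<close> by the short vector \<open>d\<close> that
  changes the rows active at \<open>y\<close> by \<open>b' - b\<close> makes it satisfy these constraints, and then
  \<open>x - y\<close> has a nonpositive product with \<open>x + d - y\<close>.
\<close>
lemma feasible_hausdorff_lipschitz:
  fixes U :: "real^'n^'m"
  assumes "\<omega> > 0" and nonempty: "feasible U b' \<noteq> {}"
    and rows: "\<And>y z. y \<in> feasible U b' \<Longrightarrow>
      \<omega>\<^sup>2 * (\<Sum>i\<in>active U b' y. (z i)\<^sup>2) \<le> (norm (\<Sum>i\<in>active U b' y. z i *\<^sub>R U $ i))\<^sup>2"
    and x: "x \<in> feasible U b"
  shows "\<exists>y\<in>feasible U b'. norm (x - y) \<le> norm (b' - b) / \<omega>"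
proof -
  define y where "y = closest_point (feasible U b') x"
  have y: "y \<in> feasible U b'"
    unfolding y_def using closed_feasible nonempty by (rule closest_point_in_set)
  have normal: "(x - y) \<bullet> (y' - y) \<le> 0" if "y' \<in> feasible U b'" for y'
    unfolding y_def using convex_feasible closed_feasible that by (rule closest_point_dot)
  obtain d where d: "\<And>i. i \<in> active U b' y \<Longrightarrow> U $ i \<bullet> d = (b' - b) $ i" and nd: "norm d \<le> norm (b' - b) / \<omega>"
    using bounded_right_inverse_of_rows[OF \<open>\<omega> > 0\<close> rows[OF y], where b = "b' - b"] by blast
  have "(x - y) \<bullet> (x + d - y) \<le> 0"
  proof (rule normal_to_feasible_imp_inner_nonpos[OF y normal])
    fix i assume i: "i \<in> active U b' y"
    then show "U $ i \<bullet> (x + d - y) \<le> 0"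
      using d[OF i] x by (simp add: mem_feasible_iff mem_active_iff inner_add_right inner_diff_right)
  qed
  then have "(norm (x - y))\<^sup>2 \<le> - ((x - y) \<bullet> d)"
    by (simp add: power2_norm_eq_inner algebra_simps)
  also have "\<dots> \<le> norm (x - y) * norm d"
    using Cauchy_Schwarz_ineq2[of "x - y" d] by linarith
  finally have "norm (x - y) \<le> norm d"
    by (cases "x = y") (auto simp: power2_eq_square)
  then show ?thesis using nd y by (intro bexI[of _ y]) auto
qed

lemma normal_cone_eq: "normal_cone X x = {\<eta>. \<forall>y\<in>X. \<eta> \<bullet> (y - x) \<le> 0}"
proof -
  have "{\<eta>. \<forall>y\<in>X. \<eta> \<bullet> (y - x) \<le> 0} = (\<Inter>y\<in>X. {\<eta>. (y - x) \<bullet> \<eta> \<le> 0})"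
    by (auto simp: inner_commute)
  then have "closed {\<eta>. \<forall>y\<in>X. \<eta> \<bullet> (y - x) \<le> 0}"
    by (auto intro: closed_halfspace_le)
  then show ?thesis unfolding normal_cone_def by (rule closure_closed)
qed

section \<open>The moving optimizer\<close>

text \<open>
  The assumption \<open>rows\<close> is the lower bound on the Gram matrix with both quadratic forms written out.
\<close>
locale moving_polyhedron_problem =
  fixes f :: "real^'n \<Rightarrow> real" and c :: "real \<Rightarrow> real^'n" and v :: "real \<Rightarrow> real^'m"
    and U :: "real^'n^'m" and \<alpha> \<beta> \<omega> lc lv :: real
  assumes diff: "\<And>x. f differentiable at x"
    and sc: "strongly_convex \<alpha> f"
    and lip: "\<beta>-lipschitz_on UNIV (gradient f)"
    and lip_c: "lc-lipschitz_on {0..} c"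
    and lip_v: "lv-lipschitz_on {0..} v"
    and \<omega>_pos: "0 < \<omega>"
    and rows: "\<And>t x z. t \<ge> 0 \<Longrightarrow> x \<in> feasible U (v t) \<Longrightarrow>
      \<omega>\<^sup>2 * (\<Sum>i\<in>active U (v t) x. (z i)\<^sup>2) \<le> (norm (\<Sum>i\<in>active U (v t) x. z i *\<^sub>R U $ i))\<^sup>2"
    and nonempty: "\<And>t. t \<ge> 0 \<Longrightarrow> feasible U (v t) \<noteq> {}"
begin

lemma \<alpha>_pos: "0 < \<alpha>"
  using sc by (simp add: strongly_convex_def)

lemma gradient_dist: "norm (gradient f x - gradient f y) \<le> \<beta> * norm (x - y)"
  using lipschitz_onD[OF lip, of x y] by (simp add: dist_norm)

lemma gradient_mono: "\<alpha> * (norm (x - y))\<^sup>2 \<le> (gradient f x - gradient f y) \<bullet> (x - y)"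
  by (rule gradient_strongly_monotone[OF sc diff])

lemma \<alpha>_le_\<beta>: "\<alpha> \<le> \<beta>"
proof -
  obtain e :: "real^'n" where e: "norm e = 1"
    using vector_choose_size[of 1] by auto
  have "\<alpha> \<le> (gradient f e - gradient f 0) \<bullet> e"
    using gradient_mono[of e 0] e by simp
  also have "\<dots> \<le> norm (gradient f e - gradient f 0) * norm e"
    by (rule norm_cauchy_schwarz)
  also have "\<dots> \<le> \<beta>"
    using gradient_dist[of e 0] e by simp
  finally show ?thesis .
qed

lemma \<beta>_pos: "0 < \<beta>"
  using \<alpha>_pos \<alpha>_le_\<beta> by simp

lemma lc_nonneg: "0 \<le> lc" and lv_nonneg: "0 \<le> lv"
  using lip_c lip_v by (simp_all add: lipschitz_on_nonneg)

lemma dist_c: "s \<ge> 0 \<Longrightarrow> t \<ge> 0 \<Longrightarrow> norm (c t - c s) \<le> lc * \<bar>t - s\<bar>"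
  using lipschitz_onD[OF lip_c, of t s] by (simp add: dist_norm)

lemma dist_v: "s \<ge> 0 \<Longrightarrow> t \<ge> 0 \<Longrightarrow> norm (v t - v s) \<le> lv * \<bar>t - s\<bar>"
  using lipschitz_onD[OF lip_v, of t s] by (simp add: dist_norm)

lemma near_feasible:
  assumes "s \<ge> 0" "x \<in> feasible U b"
  shows "\<exists>y\<in>feasible U (v s). norm (x - y) \<le> norm (v s - b) / \<omega>"
  using feasible_hausdorff_lipschitz[OF \<omega>_pos nonempty rows] assms by blast

definition opt :: "real^'n \<Rightarrow> real^'m \<Rightarrow> real^'n" where
  "opt p b = arg_min_on (\<lambda>x. f (x - p)) (feasible U b)"

lemma ex1_opt:
  assumes "feasible U b \<noteq> {}"
  shows "\<exists>!x. is_arg_min (\<lambda>x. f (x - p)) (\<lambda>x. x \<in> feasible U b) x"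
  using translated_strongly_convex[OF sc] translated_gradient(1)[OF diff]
    closed_feasible convex_feasible assms
  by (rule strongly_convex_unique_min)

lemma
  assumes "feasible U b \<noteq> {}"
  shows opt_feasible: "opt p b \<in> feasible U b"
    and opt_variational: "\<And>y. y \<in> feasible U b \<Longrightarrow> 0 \<le> gradient f (opt p b - p) \<bullet> (y - opt p b)"
proof -
  have "is_arg_min (\<lambda>x. f (x - p)) (\<lambda>x. x \<in> feasible U b) (opt p b)"
    unfolding opt_def arg_min_on_def arg_min_def using ex1_opt[OF assms] by (metis someI_ex)
  then have min: "opt p b \<in> feasible U b" "\<And>y. y \<in> feasible U b \<Longrightarrow> f (opt p b - p) \<le> f (y - p)"
    by (auto simp: is_arg_min_linorder)
  then show "opt p b \<in> feasible U b" by blast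
  show "0 \<le> gradient f (opt p b - p) \<bullet> (y - opt p b)" if "y \<in> feasible U b" for y
    using minimizer_variational_inequality[OF translated_gradient(1)[OF diff, of p] convex_feasible min(1) that min(2)]
    by (simp add: translated_gradient(2)[OF diff])
qed

lemma opt_dist_center:
  assumes ne: "feasible U b \<noteq> {}"
  shows "norm (opt p b - opt q b) \<le> \<beta> / \<alpha> * norm (p - q)"
proof -
  let ?x = "opt p b" and ?y = "opt q b"
  have "\<alpha> * (norm (?x - ?y))\<^sup>2 \<le> (gradient f (?x - p) - gradient f (?y - p)) \<bullet> (?x - ?y)"
    using gradient_mono[of "?x - p" "?y - p"] by simp
  also have "\<dots> \<le> (gradient f (?y - q) - gradient f (?y - p)) \<bullet> (?x - ?y)"
    using opt_variational[OF ne opt_feasible[OF ne], of p q] opt_variational[OF ne opt_feasible[OF ne], of q p]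
    by (simp add: algebra_simps)
  also have "\<dots> \<le> norm (gradient f (?y - q) - gradient f (?y - p)) * norm (?x - ?y)"
    by (rule norm_cauchy_schwarz)
  also have "\<dots> \<le> \<beta> * norm (p - q) * norm (?x - ?y)"
    using gradient_dist[of "?y - q" "?y - p"] by (intro mult_right_mono) auto
  finally have "\<alpha> * norm (?x - ?y) \<le> \<beta> * norm (p - q)"
    by (cases "?x = ?y") (use \<beta>_pos in \<open>auto simp: power2_eq_square\<close>)
  then show ?thesis using \<alpha>_pos by (simp add: field_simps)
qed

text \<open>
  Each optimizer is tested in its variational inequality with a feasible point near the other
  one. The estimate is only of order \<open>sqrt h\<close>, but it holds for arbitrary active sets and gives the
  continuity that the sharp estimate presupposes.
\<close>
lemma opt_dist_bound_crude:
  fixes p :: "real^'n"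
  assumes s: "s \<ge> 0" and t: "t \<ge> 0"
  defines "D \<equiv> norm (opt p (v t) - opt p (v s))" and "h \<equiv> norm (v t - v s) / \<omega>"
  shows "\<alpha> * D\<^sup>2 \<le> (2 * norm (gradient f (opt p (v s) - p)) + \<beta> * D) * h"
proof -
  let ?x = "opt p (v t)" and ?y = "opt p (v s)"
  let ?gx = "gradient f (?x - p)" and ?gy = "gradient f (?y - p)"
  note nt = nonempty[OF t] and ns = nonempty[OF s]
  obtain y where y: "y \<in> feasible U (v s)" "norm (?x - y) \<le> h"
    using near_feasible[OF s opt_feasible[OF nt, of p]] by (auto simp: h_def norm_minus_commute)
  obtain x where x: "x \<in> feasible U (v t)" "norm (?y - x) \<le> h"
    using near_feasible[OF t opt_feasible[OF ns, of p]] by (auto simp: h_def)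
  have "\<alpha> * D\<^sup>2 \<le> (?gx - ?gy) \<bullet> (?x - ?y)"
    using gradient_mono[of "?x - p" "?y - p"] by (simp add: D_def)
  also have "\<dots> \<le> - (?gx \<bullet> (?y - x)) - ?gy \<bullet> (?x - y)"
    using opt_variational[OF nt x(1), of p] opt_variational[OF ns y(1), of p] by (simp add: algebra_simps)
  also have "\<dots> \<le> norm ?gx * h + norm ?gy * h"
  proof -
    have "- (?gx \<bullet> (?y - x)) \<le> norm ?gx * norm (?y - x)" "- (?gy \<bullet> (?x - y)) \<le> norm ?gy * norm (?x - y)"
      using Cauchy_Schwarz_ineq2[of ?gx "?y - x"] Cauchy_Schwarz_ineq2[of ?gy "?x - y"] by simp+
    moreover have "norm ?gx * norm (?y - x) \<le> norm ?gx * h" "norm ?gy * norm (?x - y) \<le> norm ?gy * h"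
      using x(2) y(2) by (simp_all add: mult_left_mono)
    ultimately show ?thesis by linarith
  qed
  also have "\<dots> \<le> (2 * norm ?gy + \<beta> * D) * h"
  proof -
    have "norm ?gx \<le> norm ?gy + \<beta> * D"
      using norm_triangle_sub[of ?gx ?gy] gradient_dist[of "?x - p" "?y - p"] by (simp add: D_def)
    then have "norm ?gx + norm ?gy \<le> 2 * norm ?gy + \<beta> * D" by simp
    then have "(norm ?gx + norm ?gy) * h \<le> (2 * norm ?gy + \<beta> * D) * h"
      by (rule mult_right_mono) (use \<omega>_pos in \<open>simp add: h_def\<close>)
    then show ?thesis by (simp add: distrib_right)
  qed
  finally show ?thesis .
qed

lemma tendsto_v: "s \<ge> 0 \<Longrightarrow> (v \<longlongrightarrow> v s) (at s within {0..})"
  using lipschitz_on_continuous_on[OF lip_v] by (simp add: continuous_on_def)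

lemma tendsto_opt:
  assumes s: "s \<ge> 0"
  shows "((\<lambda>t. opt p (v t)) \<longlongrightarrow> opt p (v s)) (at s within {0..})"
proof (rule tendstoI)
  fix e :: real assume e: "e > 0"
  let ?G = "norm (gradient f (opt p (v s) - p))"
  define h where "h t = norm (v t - v s) / \<omega>" for t
  have "(h \<longlongrightarrow> norm (v s - v s) / \<omega>) (at s within {0..})"
    unfolding h_def using \<omega>_pos by (intro tendsto_intros tendsto_v s) auto
  then have h0: "(h \<longlongrightarrow> 0) (at s within {0..})" by simp
  have l1: "((\<lambda>t. \<beta> * h t) \<longlongrightarrow> \<beta> * 0) (at s within {0..})" "((\<lambda>t. 2 * ?G * h t) \<longlongrightarrow> 2 * ?G * 0) (at s within {0..})"
    by (intro tendsto_intros h0)+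
  have "\<forall>\<^sub>F t in at s within {0..}. \<beta> * h t < \<alpha> * e / 2"
    using l1(1) by (rule order_tendstoD) (use e \<alpha>_pos in simp)
  moreover have "\<forall>\<^sub>F t in at s within {0..}. 2 * ?G * h t < \<alpha> * e\<^sup>2 / 2"
    using l1(2) by (rule order_tendstoD) (use e \<alpha>_pos in simp)
  moreover have "\<forall>\<^sub>F t in at s within {0..}. t \<in> {0..}"
    by (simp add: eventually_at_filter)
  ultimately show "\<forall>\<^sub>F t in at s within {0..}. dist (opt p (v t)) (opt p (v s)) < e"
  proof eventually_elim
    case (elim t)
    define D where "D = norm (opt p (v t) - opt p (v s))"
    have "\<alpha> * D\<^sup>2 \<le> (2 * ?G + \<beta> * D) * h t"
      unfolding D_def h_def using elim s by (intro opt_dist_bound_crude) auto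
    also have "\<dots> = 2 * ?G * h t + (\<beta> * h t) * D" by (simp add: algebra_simps)
    finally have main: "\<alpha> * D\<^sup>2 \<le> 2 * ?G * h t + (\<beta> * h t) * D" .
    show ?case
    \<comment> \<open>If \<open>D \<ge> e\<close>, each term on the right of \<open>main\<close> is at most, and one of them less than, half of the left side.\<close>
    proof (rule ccontr)
      assume "\<not> ?case"
      then have D: "e \<le> D" by (simp add: D_def dist_norm)
      have "(\<beta> * h t) * D \<le> (\<alpha> * e / 2) * D"
        using elim(1) D e by (intro mult_right_mono) auto
      also have "\<dots> \<le> \<alpha> * D\<^sup>2 / 2"
        using D e \<alpha>_pos by (simp add: power2_eq_square mult_right_mono)
      finally have "(\<beta> * h t) * D \<le> \<alpha> * D\<^sup>2 / 2" .
      moreover have "\<alpha> * e\<^sup>2 / 2 \<le> \<alpha> * D\<^sup>2 / 2"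
        using D e \<alpha>_pos by (simp add: power_mono)
      ultimately show False using main elim(2) by linarith
    qed
  qed
qed

text \<open>
  Constraints that are slack at the optimizer stay slack nearby, since the optimizer is continuous in
  the bounds.
\<close>
lemma eventually_active_subset:
  assumes s: "s \<ge> 0"
  shows "\<forall>\<^sub>F t in at s within {0..}. active U (v t) (opt p (v t)) \<subseteq> active U (v s) (opt p (v s))"
proof -
  have "\<forall>\<^sub>F t in at s within {0..}. i \<in> active U (v t) (opt p (v t)) \<longrightarrow> i \<in> active U (v s) (opt p (v s))" for i
  proof (cases "i \<in> active U (v s) (opt p (v s))")
    case False
    then have neg: "U $ i \<bullet> opt p (v s) - v s $ i < 0"
      using opt_feasible[OF nonempty[OF s], of p]
      by (auto simp: mem_feasible_iff mem_active_iff order.strict_iff_order)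
    have "((\<lambda>t. U $ i \<bullet> opt p (v t) - v t $ i) \<longlongrightarrow> U $ i \<bullet> opt p (v s) - v s $ i) (at s within {0..})"
      by (intro tendsto_intros tendsto_opt tendsto_v s)
    then have "\<forall>\<^sub>F t in at s within {0..}. U $ i \<bullet> opt p (v t) - v t $ i < 0"
      using neg by (rule order_tendstoD)
    then show ?thesis by eventually_elim (simp add: mem_active_iff)
  qed simp
  then have "\<forall>\<^sub>F t in at s within {0..}. \<forall>i. i \<in> active U (v t) (opt p (v t)) \<longrightarrow> i \<in> active U (v s) (opt p (v s))"
    by (rule eventually_all_finite)
  then show ?thesis by eventually_elim blast
qed

text \<open>
  With all constraints active at time \<open>t\<close> also active at time \<open>s\<close>, one translation \<open>d\<close> serves both
  variational inequalities: \<open>?x + d\<close> is an admissible direction seen from \<open>?y\<close>, and \<open>?y - d\<close> one seen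
  from \<open>?x\<close>. Adding them bounds \<open>(gx - gy) \<bullet> (?x - ?y)\<close> by \<open>\<parallel>gx - gy\<parallel> * Q\<close>. Cocoercivity turns
  this into \<open>\<parallel>gx - gy\<parallel> \<le> \<beta> * Q\<close>, and strong monotonicity into the claim.
\<close>
lemma opt_dist_bound:
  assumes s: "s \<ge> 0" and t: "t \<ge> 0"
    and sub: "active U (v t) (opt p (v t)) \<subseteq> active U (v s) (opt p (v s))"
  shows "norm (opt p (v t) - opt p (v s)) \<le> sqrt (\<beta> / \<alpha>) * (norm (v t - v s) / \<omega>)"
proof -
  let ?x = "opt p (v t)" and ?y = "opt p (v s)"
  define gx where "gx = gradient f (?x - p)"
  define gy where "gy = gradient f (?y - p)"
  define Q where "Q = norm (v t - v s) / \<omega>"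
  have Q: "Q \<ge> 0" using \<omega>_pos by (simp add: Q_def)
  note nt = nonempty[OF t] and ns = nonempty[OF s]
  obtain d where d: "\<And>i. i \<in> active U (v s) ?y \<Longrightarrow> U $ i \<bullet> d = (v s - v t) $ i"
    and nd: "norm d \<le> norm (v s - v t) / \<omega>"
    using bounded_right_inverse_of_rows[OF \<omega>_pos rows[OF s opt_feasible[OF ns]], where b = "v s - v t"] by blast
  have "(- gy) \<bullet> (?x + d - ?y) \<le> 0"
  proof (rule normal_to_feasible_imp_inner_nonpos[OF opt_feasible[OF ns]])
    show "(- gy) \<bullet> (y - ?y) \<le> 0" if "y \<in> feasible U (v s)" for y
      using opt_variational[OF ns that] by (simp add: gy_def)
    show "U $ i \<bullet> (?x + d - ?y) \<le> 0" if "i \<in> active U (v s) ?y" for i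
      using d[OF that] that opt_feasible[OF nt, of p]
      by (simp add: mem_feasible_iff mem_active_iff inner_add_right inner_diff_right)
  qed
  moreover have "(- gx) \<bullet> (?y - d - ?x) \<le> 0"
  proof (rule normal_to_feasible_imp_inner_nonpos[OF opt_feasible[OF nt]])
    show "(- gx) \<bullet> (y - ?x) \<le> 0" if "y \<in> feasible U (v t)" for y
      using opt_variational[OF nt that] by (simp add: gx_def)
    show "U $ i \<bullet> (?y - d - ?x) \<le> 0" if "i \<in> active U (v t) ?x" for i
      using d[of i] that sub opt_feasible[OF ns, of p]
      by (auto simp: mem_feasible_iff mem_active_iff inner_diff_right)
  qed
  ultimately have "(gx - gy) \<bullet> (?x - ?y) \<le> - ((gx - gy) \<bullet> d)"
    by (simp add: algebra_simps)
  also have "\<dots> \<le> norm (gx - gy) * norm d"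
    using Cauchy_Schwarz_ineq2[of "gx - gy" d] by simp
  also have "\<dots> \<le> norm (gx - gy) * Q"
    using nd by (intro mult_left_mono) (auto simp: Q_def norm_minus_commute)
  finally have up: "(gx - gy) \<bullet> (?x - ?y) \<le> norm (gx - gy) * Q" .
  have "(norm (gx - gy))\<^sup>2 \<le> \<beta> * ((gx - gy) \<bullet> (?x - ?y))"
    using gradient_cocoercive[OF sc diff lip \<beta>_pos, of "?x - p" "?y - p"] by (simp add: gx_def gy_def)
  also have "\<dots> \<le> \<beta> * (norm (gx - gy) * Q)"
    using up \<beta>_pos by simp
  finally have "norm (gx - gy) \<le> \<beta> * Q"
    using \<beta>_pos Q by (cases "gx = gy") (auto simp: power2_eq_square)
  then have "norm (gx - gy) * Q \<le> \<beta> * Q * Q" using Q by (rule mult_right_mono)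
  moreover have "\<alpha> * (norm (?x - ?y))\<^sup>2 \<le> (gx - gy) \<bullet> (?x - ?y)"
    using gradient_mono[of "?x - p" "?y - p"] by (simp add: gx_def gy_def)
  ultimately have "\<alpha> * (norm (?x - ?y))\<^sup>2 \<le> \<beta> * Q\<^sup>2"
    using up by (simp add: power2_eq_square)
  then have "(norm (?x - ?y))\<^sup>2 \<le> \<beta> / \<alpha> * Q\<^sup>2"
    using \<alpha>_pos by (simp add: field_simps)
  then have "norm (?x - ?y) \<le> sqrt (\<beta> / \<alpha> * Q\<^sup>2)" by (rule real_le_rsqrt)
  moreover have "sqrt (\<beta> / \<alpha> * Q\<^sup>2) = sqrt (\<beta> / \<alpha>) * Q"
    unfolding real_sqrt_mult using Q by simp
  ultimately show ?thesis by (simp add: Q_def)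
qed

definition xopt :: "real \<Rightarrow> real^'n" where
  "xopt t = opt (c t) (v t)"

definition speed :: real where
  "speed = \<beta> / \<alpha> * lc + sqrt (\<beta> / \<alpha>) * (lv / \<omega>)"

text \<open>
  The move from \<open>xopt s\<close> to \<open>xopt t\<close> is split at the optimizer for the center at time \<open>s\<close> and the
  bounds at time \<open>t\<close>. The center changes while the feasible set is frozen, and the bounds change while
  the center is frozen, so that each half is covered by one of the two estimates above.
\<close>
lemma xopt_locally_lipschitz:
  assumes s: "s \<ge> 0"
  shows "\<exists>d>0. \<forall>t\<ge>0. \<bar>t - s\<bar> < d \<longrightarrow> norm (xopt t - xopt s) \<le> speed * \<bar>t - s\<bar>"
proof -
  obtain d where d: "d > 0" and act: "\<And>t. t \<ge> 0 \<Longrightarrow> t \<noteq> s \<Longrightarrow> dist t s < d \<Longrightarrow>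
      active U (v t) (opt (c s) (v t)) \<subseteq> active U (v s) (opt (c s) (v s))"
    using eventually_active_subset[OF s, of "c s"] unfolding eventually_at by auto
  have "norm (xopt t - xopt s) \<le> speed * \<bar>t - s\<bar>" if t: "t \<ge> 0" "\<bar>t - s\<bar> < d" for t
  proof (cases "t = s")
    case False
    have "norm (xopt t - xopt s)
        \<le> norm (opt (c t) (v t) - opt (c s) (v t)) + norm (opt (c s) (v t) - opt (c s) (v s))"
      unfolding xopt_def using norm_triangle_ineq[of "opt (c t) (v t) - opt (c s) (v t)" "opt (c s) (v t) - opt (c s) (v s)"] by simp
    also have "\<dots> \<le> \<beta> / \<alpha> * (lc * \<bar>t - s\<bar>) + sqrt (\<beta> / \<alpha>) * (lv * \<bar>t - s\<bar> / \<omega>)"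
    proof (rule add_mono)
      show "norm (opt (c t) (v t) - opt (c s) (v t)) \<le> \<beta> / \<alpha> * (lc * \<bar>t - s\<bar>)"
        using opt_dist_center[OF nonempty[OF t(1)]] dist_c[OF s t(1)] \<alpha>_pos \<beta>_pos
        by (meson divide_nonneg_pos less_imp_le mult_left_mono order_trans)
      have "norm (opt (c s) (v t) - opt (c s) (v s)) \<le> sqrt (\<beta> / \<alpha>) * (norm (v t - v s) / \<omega>)"
        using act[of t] t False by (intro opt_dist_bound s) (auto simp: dist_real_def)
      also have "\<dots> \<le> sqrt (\<beta> / \<alpha>) * (lv * \<bar>t - s\<bar> / \<omega>)"
        using dist_v[OF s t(1)] \<alpha>_pos \<beta>_pos \<omega>_pos by (intro mult_left_mono divide_right_mono) auto
      finally show "norm (opt (c s) (v t) - opt (c s) (v s)) \<le> sqrt (\<beta> / \<alpha>) * (lv * \<bar>t - s\<bar> / \<omega>)" .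
    qed
    also have "\<dots> = speed * \<bar>t - s\<bar>"
      by (simp add: speed_def algebra_simps)
    finally show ?thesis .
  qed simp
  then show ?thesis using d by blast
qed

lemma xopt_lipschitz:
  assumes "0 \<le> s" "s \<le> t"
  shows "norm (xopt t - xopt s) \<le> speed * (t - s)"
proof -
  \<comment> \<open>Subdivision may produce intervals that begin before time 0, where nothing is known.\<close>
  define P where "P a b \<longleftrightarrow> (0 \<le> a \<longrightarrow> norm (xopt b - xopt a) \<le> speed * (b - a))" for a b
  have "P s t"
    using \<open>s \<le> t\<close>
  proof (induction rule: Bolzano)
    case (trans a b d)
    show ?case unfolding P_def
    proof
      assume "0 \<le> a"
      then have "norm (xopt d - xopt b) + norm (xopt b - xopt a) \<le> speed * (d - b) + speed * (b - a)"
        using trans unfolding P_def by (intro add_mono) auto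
      also have "\<dots> = speed * (d - a)" by (simp add: algebra_simps)
      finally show "norm (xopt d - xopt a) \<le> speed * (d - a)"
        using norm_triangle_ineq[of "xopt d - xopt b" "xopt b - xopt a"] by simp
    qed
  next
    case (local r)
    then have "r \<ge> 0" using \<open>0 \<le> s\<close> by simp
    then obtain d where "d > 0" and d: "\<And>t. t \<ge> 0 \<Longrightarrow> \<bar>t - r\<bar> < d \<Longrightarrow> norm (xopt t - xopt r) \<le> speed * \<bar>t - r\<bar>"
      using xopt_locally_lipschitz by blast
    have "P a b" if ab: "a \<le> r" "r \<le> b" "b - a < d" for a b
      unfolding P_def
    proof
      assume "0 \<le> a"
      have "norm (xopt b - xopt r) \<le> speed * (b - r)" "norm (xopt a - xopt r) \<le> speed * (r - a)"
        using d[of b] d[of a] ab \<open>0 \<le> a\<close> by auto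
      then have "norm (xopt b - xopt r) + norm (xopt r - xopt a) \<le> speed * (b - r) + speed * (r - a)"
        by (simp add: norm_minus_commute)
      also have "\<dots> = speed * (b - a)" by (simp add: algebra_simps)
      finally show "norm (xopt b - xopt a) \<le> speed * (b - a)"
        using norm_triangle_ineq[of "xopt b - xopt r" "xopt r - xopt a"] by simp
    qed
    then show ?case using \<open>d > 0\<close> by blast
  qed
  then show ?thesis using \<open>0 \<le> s\<close> by (simp add: P_def)
qed

end

section \<open>Tracking of the optimizer by solutions\<close>

context moving_polyhedron_problem
begin

abbreviation drift :: "real^'n \<Rightarrow> real \<Rightarrow> (real^'n) set" where
  "drift x t \<equiv> {- gradient f (x - c t)}"

abbreviation region :: "real \<Rightarrow> (real^'n) set" where
  "region t \<equiv> feasible U (v t)"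

lemma xopt_feasible: "t \<ge> 0 \<Longrightarrow> xopt t \<in> region t"
  unfolding xopt_def by (intro opt_feasible nonempty)

lemma speed_nonneg: "0 \<le> speed"
  using \<alpha>_pos \<beta>_pos \<omega>_pos lc_nonneg lv_nonneg by (simp add: speed_def)

text \<open>
  The optimizer is feasible, so the normal vector \<open>\<eta>\<close> does not point towards it; the rest is strong
  monotonicity combined with the variational inequality of the optimizer.
\<close>
lemma velocity_contracts:
  assumes t: "t \<ge> 0" and x: "x \<in> region t" and \<eta>: "\<eta> \<in> normal_cone (region t) x"
  shows "(x - xopt t) \<bullet> (- gradient f (x - c t) - \<eta>) \<le> - \<alpha> * (norm (x - xopt t))\<^sup>2"
proof -
  have "\<eta> \<bullet> (xopt t - x) \<le> 0"
    using \<eta> xopt_feasible[OF t] by (simp add: normal_cone_eq)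
  moreover have "0 \<le> gradient f (xopt t - c t) \<bullet> (x - xopt t)"
    unfolding xopt_def by (rule opt_variational[OF nonempty[OF t] x])
  moreover have "\<alpha> * (norm (x - xopt t))\<^sup>2 \<le> (gradient f (x - c t) - gradient f (xopt t - c t)) \<bullet> (x - xopt t)"
    using gradient_mono[of "x - c t" "xopt t - c t"] by simp
  ultimately show ?thesis by (simp add: algebra_simps inner_commute)
qed

text \<open>
  The distance to the frozen point \<open>xopt t\<close> is differentiable at \<open>t\<close>, as it is positive there, with
  slope at most \<open>- \<alpha> * r\<close>. Replacing \<open>xopt t\<close> by \<open>xopt u\<close> and \<open>xopt v\<close> costs at most
  \<open>speed * (v - u)\<close>.
\<close>
lemma tracking_error_decreases_locally:
  assumes t: "t \<in> {0..T}" and far: "r \<le> norm (x t - xopt t)" and "r > 0"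
    and x: "x t \<in> region t" and \<eta>: "\<eta> \<in> normal_cone (region t) (x t)"
    and der: "(x has_vector_derivative (- gradient f (x t - c t) - \<eta>)) (at t within {0..T})"
    and "e > 0"
  shows "\<exists>d>0. \<forall>u\<in>{0..T}. \<forall>v\<in>{0..T}. u \<le> t \<and> t \<le> v \<and> v - u < d \<longrightarrow>
    norm (x v - xopt v) - norm (x u - xopt u) \<le> (speed - \<alpha> * r + e) * (v - u)"
proof -
  define w where "w = - gradient f (x t - c t) - \<eta>"
  define q where "q = x t - xopt t"
  have q0: "q \<noteq> 0" "norm q > 0" "r \<le> norm q" using far \<open>r > 0\<close> by (auto simp: q_def)
  define n where "n s = norm (x s - xopt t)" for s
  have "((\<lambda>s. x s - xopt t) has_derivative (\<lambda>h. h *\<^sub>R w)) (at t within {0..T})"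
    using der unfolding w_def has_vector_derivative_def by (auto intro!: derivative_eq_intros)
  moreover have "(norm has_derivative (\<lambda>h. h \<bullet> sgn q)) (at (x t - xopt t))"
    using q0 unfolding q_def by (intro has_derivative_norm)
  ultimately have "((\<lambda>s. norm (x s - xopt t)) has_derivative (\<lambda>h. (h *\<^sub>R w) \<bullet> sgn q)) (at t within {0..T})"
    by (rule has_derivative_compose)
  then have dn: "(n has_real_derivative (w \<bullet> sgn q)) (at t within {0..T})"
    unfolding n_def has_field_derivative_def by (simp add: mult_commute_abs)
  have "w \<bullet> sgn q = (q \<bullet> w) / norm q"
    by (simp add: sgn_div_norm inner_commute divide_inverse)
  also have "\<dots> \<le> - \<alpha> * (norm q)\<^sup>2 / norm q"
    using velocity_contracts[OF _ x \<eta>] t by (intro divide_right_mono) (auto simp: q_def w_def)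
  also have "\<dots> \<le> - \<alpha> * r"
    using q0 \<alpha>_pos by (simp add: power2_eq_square)
  finally have slope: "w \<bullet> sgn q \<le> - \<alpha> * r" .
  obtain d where d: "d > 0" and dd: "\<And>u v. u \<in> {0..T} \<Longrightarrow> v \<in> {0..T} \<Longrightarrow> u \<le> t \<Longrightarrow> t \<le> v \<Longrightarrow> v - u < d \<Longrightarrow>
      n v - n u \<le> (w \<bullet> sgn q + e) * (v - u)"
    using derivative_straddle[OF dn \<open>e > 0\<close>] by blast
  have "norm (x v - xopt v) - norm (x u - xopt u) \<le> (speed - \<alpha> * r + e) * (v - u)"
    if uv: "u \<in> {0..T}" "v \<in> {0..T}" "u \<le> t" "t \<le> v" "v - u < d" for u v
  proof -
    have "norm (x v - xopt v) \<le> n v + speed * (v - t)"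
      using norm_triangle_ineq4[of "x v - xopt t" "xopt v - xopt t"] xopt_lipschitz[of t v] uv t by (simp add: n_def)
    moreover have "n u \<le> norm (x u - xopt u) + speed * (t - u)"
      using norm_triangle_ineq4[of "x u - xopt u" "xopt t - xopt u"] xopt_lipschitz[of u t] uv t by (simp add: n_def)
    moreover have "n v - n u \<le> (- \<alpha> * r + e) * (v - u)"
      using dd[OF uv] slope uv by (elim order_trans) (intro mult_right_mono, auto)
    ultimately show ?thesis by (simp add: algebra_simps)
  qed
  then show ?thesis using d by blast
qed

text \<open>
  The error may grow while it is below \<open>r\<close>. Therefore the truncated error \<open>max 0 (V t - r)\<close> is shown to
  be nonincreasing first; an error above \<open>r\<close> at time \<open>T\<close> must then have been above \<open>r\<close> all along, and
  so has decreased with slope at most \<open>speed - \<alpha> * r\<close> during all of the interval.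
\<close>
lemma tracking_error_bound:
  assumes sol: "complete_sweeping_solution drift region x"
    and r: "r > 0" "speed \<le> \<alpha> * r" and T: "T > 0"
    and far: "norm (x T - xopt T) > r"
  shows "norm (x T - xopt T) \<le> norm (x 0 - xopt 0) - (\<alpha> * r - speed) * T"
proof -
  define V where "V t = norm (x t - xopt t)" for t
  have ac: "absolutely_continuous_on {0..T} x" and feas: "\<And>t. t \<in> {0..T} \<Longrightarrow> x t \<in> region t"
    and ae: "AE t in lebesgue_on {0..T}. \<exists>p\<in>drift (x t) t. \<exists>\<eta>\<in>normal_cone (region t) (x t).
        (x has_vector_derivative (p - \<eta>)) (at t within {0..T})"
    using sol T by (auto simp: complete_sweeping_solution_def sweeping_solution_def)
  obtain N where N: "negligible N" and der: "\<And>t. t \<in> {0..T} - N \<Longrightarrow> \<exists>\<eta>\<in>normal_cone (region t) (x t).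
        (x has_vector_derivative (- gradient f (x t - c t) - \<eta>)) (at t within {0..T})"
  proof -
    obtain N where "N \<in> null_sets (lebesgue_on {0..T})" and *: "{t \<in> space (lebesgue_on {0..T}).
        \<not> (\<exists>p\<in>drift (x t) t. \<exists>\<eta>\<in>normal_cone (region t) (x t).
        (x has_vector_derivative (p - \<eta>)) (at t within {0..T}))} \<subseteq> N"
      using ae unfolding eventually_ae_filter by blast
    then have "N \<in> null_sets lebesgue"
      using null_sets_restrict_space[of "{0..T}" lebesgue N] by simp
    then show ?thesis using * that[of N] by (auto simp: negligible_iff_null_sets)
  qed
  have V_diff: "\<bar>V t - V s\<bar> \<le> norm (x t - x s) + speed * (t - s)" if "0 \<le> s" "s \<le> t" for s t
    using norm_triangle_ineq3[of "x t - xopt t" "x s - xopt s"] xopt_lipschitz[OF that]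
      norm_triangle_ineq4[of "x t - x s" "xopt t - xopt s"]
    by (simp add: V_def algebra_simps)
  have dom: "norm (x t - x s) + speed * (t - s) \<le> (1 + speed) * (norm (x t - x s) + (t - s))" if "s \<le> t" for s t
    using that mult_nonneg_nonneg[OF speed_nonneg norm_ge_zero[of "x t - x s"]] by (simp add: algebra_simps)
  have step: "\<exists>d>0. \<forall>u\<in>{0..T}. \<forall>v\<in>{0..T}. u \<le> t \<and> t \<le> v \<and> v - u < d \<longrightarrow>
      V v - V u \<le> (speed - \<alpha> * r + e) * (v - u)"
    if "t \<in> {0..T} - N" "r \<le> V t" "e > 0" for t e
    unfolding V_def
    using der[OF that(1)] feas[of t] that r(1) tracking_error_decreases_locally[of t T r x _ e]
    by (fastforce simp: V_def)
  have truncated: "max 0 (V T - r) \<le> max 0 (V a - r)" if a: "a \<in> {0..T}" for a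
  proof (rule absolutely_continuous_on_nonincreasing[where g = "\<lambda>t. max 0 (V t - r)", OF _ N])
    show "absolutely_continuous_on {a..T} (\<lambda>t. max 0 (V t - r))"
    proof (rule absolutely_continuous_on_dominated)
      show "absolutely_continuous_on {a..T} x"
        using ac by (rule absolutely_continuous_on_subset) (use a in auto)
      show "norm (max 0 (V t - r) - max 0 (V s - r)) \<le> (1 + speed) * (norm (x t - x s) + (t - s))"
        if "s \<in> {a..T}" "t \<in> {a..T}" "s \<le> t" for s t
        using V_diff[of s t] dom[of s t] that a by (auto simp: max_def)
    qed (use speed_nonneg in simp)
    fix t e :: real assume t: "t \<in> {a..T} - N" and e: "e > 0"
    then have t': "t \<in> {0..T} - N" using a by auto
    show "\<exists>d>0. \<forall>u\<in>{a..T}. \<forall>v\<in>{a..T}. u \<le> t \<and> t \<le> v \<and> v - u < d \<longrightarrow>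
        max 0 (V v - r) - max 0 (V u - r) \<le> e * (v - u)"
    proof (cases "r \<le> V t")
      case True
      obtain d where "d > 0" and d: "\<And>u v. u \<in> {0..T} \<Longrightarrow> v \<in> {0..T} \<Longrightarrow> u \<le> t \<Longrightarrow> t \<le> v \<Longrightarrow> v - u < d \<Longrightarrow>
          V v - V u \<le> (speed - \<alpha> * r + e) * (v - u)"
        using step[OF t' True e] by blast
      have "max 0 (V v - r) - max 0 (V u - r) \<le> e * (v - u)"
        if "u \<in> {a..T}" "v \<in> {a..T}" "u \<le> t" "t \<le> v" "v - u < d" for u v
      proof -
        have "V v - V u \<le> (speed - \<alpha> * r + e) * (v - u)" using d[of u v] that a by auto
        also have "\<dots> \<le> e * (v - u)" using r that by (intro mult_right_mono) auto
        finally have "V v - V u \<le> e * (v - u)" .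
        moreover have "0 \<le> e * (v - u)" using e that by simp
        ultimately show ?thesis by linarith
      qed
      then show ?thesis using \<open>d > 0\<close> by blast
    next
      case False
      obtain \<eta> where "(x has_vector_derivative (- gradient f (x t - c t) - \<eta>)) (at t within {0..T})"
        using der[OF t'] by blast
      then have "(x \<longlongrightarrow> x t) (at t within {0..T})"
        unfolding continuous_within[symmetric] by (rule has_vector_derivative_continuous)
      then have "((\<lambda>s. norm (x s - x t) + speed * \<bar>s - t\<bar>) \<longlongrightarrow> norm (x t - x t) + speed * \<bar>t - t\<bar>) (at t within {0..T})"
        by (intro tendsto_intros)
      then have "\<forall>\<^sub>F s in at t within {0..T}. norm (x s - x t) + speed * \<bar>s - t\<bar> < r - V t"
        by (rule order_tendstoD) (use False in simp)
      then obtain d where "d > 0" and d: "\<And>s. s \<in> {0..T} \<Longrightarrow> s \<noteq> t \<Longrightarrow> dist s t < d \<Longrightarrow>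
          norm (x s - x t) + speed * \<bar>s - t\<bar> < r - V t"
        unfolding eventually_at by blast
      have below: "V s < r" if "s \<in> {0..T}" "\<bar>s - t\<bar> < d" for s
      proof (cases "s = t")
        case False
        have "\<bar>V s - V t\<bar> \<le> norm (x s - x t) + speed * \<bar>s - t\<bar>"
          using V_diff[of s t] V_diff[of t s] that t'
          by (cases "s \<le> t") (auto simp: norm_minus_commute abs_minus_commute)
        then show ?thesis using d[of s] False that by (simp add: dist_real_def)
      qed (use \<open>\<not> r \<le> V t\<close> in simp)
      have "max 0 (V v - r) - max 0 (V u - r) \<le> e * (v - u)"
        if "u \<in> {a..T}" "v \<in> {a..T}" "u \<le> t" "t \<le> v" "v - u < d" for u v
        using below[of u] below[of v] that a e by simp
      then show ?thesis using \<open>d > 0\<close> by blast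
    qed
  qed (use a in simp)
  have above: "V t > r" if "t \<in> {0..T}" for t
    using truncated[OF that] far by (auto simp: V_def max_def split: if_splits)
  define \<mu> where "\<mu> = \<alpha> * r - speed"
  have \<mu>: "\<mu> \<ge> 0" "speed - \<alpha> * r = - \<mu>" using r by (simp_all add: \<mu>_def)
  have "V T + \<mu> * T \<le> V 0 + \<mu> * 0"
  proof (rule absolutely_continuous_on_nonincreasing[where g = "\<lambda>t. V t + \<mu> * t", OF _ N])
    show "absolutely_continuous_on {0..T} (\<lambda>t. V t + \<mu> * t)"
    proof (rule absolutely_continuous_on_dominated[OF ac, of "1 + speed + \<mu>"])
      show "norm (V t + \<mu> * t - (V s + \<mu> * s)) \<le> (1 + speed + \<mu>) * (norm (x t - x s) + (t - s))"
        if "s \<in> {0..T}" "t \<in> {0..T}" "s \<le> t" for s t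
      proof -
        have "\<bar>V t + \<mu> * t - (V s + \<mu> * s)\<bar> \<le> \<bar>V t - V s\<bar> + \<mu> * (t - s)"
        proof -
          have "V t + \<mu> * t - (V s + \<mu> * s) = (V t - V s) + \<mu> * (t - s)" by (simp add: algebra_simps)
          moreover have "0 \<le> \<mu> * (t - s)" using \<mu> that by simp
          ultimately show ?thesis by linarith
        qed
        also have "\<dots> \<le> (1 + speed) * (norm (x t - x s) + (t - s)) + \<mu> * (norm (x t - x s) + (t - s))"
          using V_diff[of s t] dom[of s t] that \<mu> by (intro add_mono mult_left_mono) auto
        finally show ?thesis by (simp add: algebra_simps)
      qed
    qed (use speed_nonneg \<mu> in simp)
    fix t e :: real assume t: "t \<in> {0..T} - N" and e: "e > 0"
    have "r \<le> V t" using above[of t] t by simp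
    from step[OF t this e, unfolded \<mu>] show "\<exists>d>0. \<forall>u\<in>{0..T}. \<forall>v\<in>{0..T}. u \<le> t \<and> t \<le> v \<and> v - u < d \<longrightarrow>
        V v + \<mu> * v - (V u + \<mu> * u) \<le> e * (v - u)"
      by (simp add: algebra_simps)
  qed (use T in simp)
  then show ?thesis by (simp add: V_def \<mu>_def)
qed

text \<open>
  For every level \<open>r' > r\<close> an error above \<open>r'\<close> decreases with a positive speed, so it falls to \<open>r'\<close>
  within finite time and does not exceed it again.
\<close>
lemma ultimate_tracking_error:
  assumes sol: "complete_sweeping_solution drift region x" and r: "speed / \<alpha> \<le> r"
  shows "Limsup at_top (\<lambda>t. ereal (norm (x t - xopt t))) \<le> ereal r"
    and "norm (x 0 - xopt 0) \<le> r \<Longrightarrow> 0 \<le> t \<Longrightarrow> norm (x t - xopt t) \<le> r"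
proof -
  have "0 \<le> speed / \<alpha>" using speed_nonneg \<alpha>_pos by simp
  then have r0: "0 \<le> r" using r by linarith
  have bound: "norm (x T - xopt T) \<le> r' \<or> norm (x T - xopt T) \<le> norm (x 0 - xopt 0) - (\<alpha> * r' - speed) * T"
    and margin: "0 < \<alpha> * r' - speed" if "r < r'" "0 < T" for r' T
  proof -
    have "speed / \<alpha> < r'" using r that by linarith
    then show "0 < \<alpha> * r' - speed" using \<alpha>_pos by (simp add: field_simps)
    then show "norm (x T - xopt T) \<le> r' \<or> norm (x T - xopt T) \<le> norm (x 0 - xopt 0) - (\<alpha> * r' - speed) * T"
      using tracking_error_bound[OF sol, of r' T] that r0 by force
  qed
  show "Limsup at_top (\<lambda>t. ereal (norm (x t - xopt t))) \<le> ereal r"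
  proof (rule ereal_le_epsilon2)
    fix e :: real assume e: "0 < e"
    define r' where "r' = r + e"
    have "r < r'" using e by (simp add: r'_def)
    define \<mu> where "\<mu> = \<alpha> * r' - speed"
    have \<mu>: "\<mu> > 0" unfolding \<mu>_def using margin[OF \<open>r < r'\<close>, of 1] by simp
    have late: "norm (x t - xopt t) \<le> r'" if t: "norm (x 0 - xopt 0) / \<mu> < t" for t
    proof -
      have "0 \<le> norm (x 0 - xopt 0) / \<mu>" using \<mu> by simp
      then have "t > 0" using t by linarith
      moreover have "norm (x 0 - xopt 0) - \<mu> * t < 0" using t \<mu> by (simp add: field_simps)
      ultimately show ?thesis
        using bound[OF \<open>r < r'\<close>, of t] norm_ge_zero[of "x t - xopt t"] unfolding \<mu>_def by linarith
    qed
    have "\<forall>\<^sub>F t in at_top. ereal (norm (x t - xopt t)) \<le> ereal r'"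
      by (rule eventually_mono[OF eventually_gt_at_top[of "norm (x 0 - xopt 0) / \<mu>"]]) (use late in simp)
    then show "Limsup at_top (\<lambda>t. ereal (norm (x t - xopt t))) \<le> ereal r + ereal e"
      by (intro Limsup_bounded) (simp add: r'_def)
  qed
  show "norm (x t - xopt t) \<le> r" if start: "norm (x 0 - xopt 0) \<le> r" and t: "0 \<le> t"
  proof (cases "t = 0")
    case False
    then have "t > 0" using t by simp
    have "norm (x t - xopt t) \<le> r + e" if "e > 0" for e
    proof -
      have "r < r + e" using that by simp
      have "0 \<le> (\<alpha> * (r + e) - speed) * t"
        using margin[OF \<open>r < r + e\<close> \<open>t > 0\<close>] t by simp
      then show ?thesis using bound[OF \<open>r < r + e\<close> \<open>t > 0\<close>] start that by linarith
    qed
    then show ?thesis by (rule field_le_epsilon)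
  qed (use start in simp)
qed

text \<open>
  The two sides differ by a factor \<open>sqrt (\<beta> / \<alpha>) \<ge> 1\<close> in the term that contains \<open>lc\<close>.
\<close>
lemma speed_div_\<alpha>_le:
  "speed / \<alpha> \<le> \<beta> powr (1/2) / \<alpha> powr (3/2) * (\<beta> * lc / \<alpha> + lv / \<omega>)"
proof -
  have s1: "1 \<le> sqrt (\<beta> / \<alpha>)"
    using \<alpha>_pos \<alpha>_le_\<beta> by simp
  have "\<beta> / \<alpha> * lc \<le> sqrt (\<beta> / \<alpha>) * (\<beta> * lc / \<alpha>)"
    using mult_right_mono[OF s1, of "\<beta> * lc / \<alpha>"] \<alpha>_pos \<beta>_pos lc_nonneg by simp
  then have "speed \<le> sqrt (\<beta> / \<alpha>) * (\<beta> * lc / \<alpha> + lv / \<omega>)"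
    by (simp add: speed_def distrib_left)
  then have "speed / \<alpha> \<le> sqrt (\<beta> / \<alpha>) / \<alpha> * (\<beta> * lc / \<alpha> + lv / \<omega>)"
    using \<alpha>_pos by (simp add: divide_right_mono)
  also have "sqrt (\<beta> / \<alpha>) / \<alpha> = \<beta> powr (1/2) / \<alpha> powr (3/2)"
  proof -
    have "\<alpha> powr (3/2) = \<alpha> powr (1/2 + 1)" by simp
    also have "\<dots> = sqrt \<alpha> * \<alpha>"
      unfolding powr_add using \<alpha>_pos by (simp add: powr_half_sqrt)
    finally show ?thesis
      using \<beta>_pos by (simp add: powr_half_sqrt real_sqrt_divide)
  qed
  finally show ?thesis .
qed

end

section \<open>Existence of solutions by the catching-up scheme\<close>

text \<open>
  Tychonoff's theorem for the product of the balls. The limit is taken along a filter finer than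
  \<open>sequentially\<close> because a product over uncountably many indices need not be sequentially compact.
\<close>
lemma pointwise_cluster_function:
  fixes y :: "nat \<Rightarrow> 'b \<Rightarrow> 'a::euclidean_space"
  assumes bdd: "\<And>n t. y n t \<in> cball a (r t)"
  obtains F x where "F \<noteq> bot" "F \<le> sequentially" "\<And>t. ((\<lambda>n. y n t) \<longlongrightarrow> x t) F"
proof -
  let ?K = "PiE UNIV (\<lambda>t. cball a (r t))"
  have "compactin (product_topology (\<lambda>t::'b. euclidean) UNIV) ?K"
    unfolding compactin_PiE by (simp add: compactin_euclidean_iff)
  then have "compact ?K"
    by (simp add: euclidean_product_topology compactin_euclidean_iff)
  moreover have "\<forall>\<^sub>F f in filtermap y sequentially. f \<in> ?K"
    using bdd by (simp add: eventually_filtermap PiE_def Pi_def)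
  moreover have "filtermap y sequentially \<noteq> bot" by (simp add: filtermap_bot_iff)
  ultimately obtain x where x: "inf (nhds x) (filtermap y sequentially) \<noteq> bot"
    unfolding compact_filter by blast
  define F where "F = inf (filtercomap y (nhds x)) sequentially"
  have "F \<noteq> bot"
  proof
    assume "F = bot"
    then have "\<forall>\<^sub>F n in F. False" by simp
    then obtain P Q where PQ: "eventually P (filtercomap y (nhds x))" "eventually Q sequentially"
      "\<And>n. P n \<Longrightarrow> Q n \<Longrightarrow> False"
      unfolding F_def eventually_inf by blast
    obtain P' where P': "eventually P' (nhds x)" "\<And>n. P' (y n) \<Longrightarrow> P n"
      using PQ(1) unfolding eventually_filtercomap by blast
    have "\<forall>\<^sub>F f in filtermap y sequentially. \<not> P' f"
      unfolding eventually_filtermap using PQ(2) by eventually_elim (use P' PQ in blast)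
    then have "\<forall>\<^sub>F f in inf (nhds x) (filtermap y sequentially). False"
      unfolding eventually_inf using P'(1) by blast
    then show False using x by (simp add: trivial_limit_def)
  qed
  moreover have "F \<le> sequentially" by (simp add: F_def)
  moreover have "((\<lambda>n. y n t) \<longlongrightarrow> x t) F" for t
  proof -
    have lim: "filterlim y (nhds x) F"
      unfolding filterlim_iff_le_filtercomap F_def by simp
    show ?thesis
    proof (rule topological_tendstoI)
      fix S assume "open S" "x t \<in> S"
      then have "open ((\<lambda>f :: 'b \<Rightarrow> 'a. f t) -` S)" "x \<in> (\<lambda>f. f t) -` S"
        by (auto intro: open_vimage continuous_on_product_coordinates)
      then have "\<forall>\<^sub>F f in nhds x. f \<in> (\<lambda>f. f t) -` S"
        by (rule eventually_nhds_in_open)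
      then show "\<forall>\<^sub>F n in F. y n t \<in> S"
        using lim by (auto simp: filterlim_iff)
    qed
  qed
  ultimately show ?thesis using that by blast
qed

context moving_polyhedron_problem
begin

abbreviation grad :: "real^'n \<Rightarrow> real \<Rightarrow> real^'n" where
  "grad x t \<equiv> gradient f (x - c t)"

lemma grad_dist:
  assumes "0 \<le> s" "0 \<le> t"
  shows "norm (grad x t - grad y s) \<le> \<beta> * (norm (x - y) + lc * \<bar>t - s\<bar>)"
proof -
  have "norm (grad x t - grad y s) \<le> \<beta> * norm ((x - y) - (c t - c s))"
    using gradient_dist[of "x - c t" "y - c s"] by (simp add: algebra_simps)
  also have "\<dots> \<le> \<beta> * (norm (x - y) + lc * \<bar>t - s\<bar>)"
    using norm_triangle_ineq4[of "x - y" "c t - c s"] dist_c[OF assms] \<beta>_pos by (intro mult_left_mono) auto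
  finally show ?thesis .
qed

definition region_speed :: real where "region_speed = lv / \<omega>"

lemma region_speed_nonneg: "0 \<le> region_speed"
  using lv_nonneg \<omega>_pos by (simp add: region_speed_def)

lemma near_region:
  assumes "0 \<le> s" "0 \<le> t" "z \<in> region s"
  shows "\<exists>y\<in>region t. norm (z - y) \<le> region_speed * \<bar>t - s\<bar>"
proof -
  obtain y where "y \<in> region t" "norm (z - y) \<le> norm (v t - v s) / \<omega>"
    using near_feasible[OF assms(2,3)] by blast
  moreover have "norm (v t - v s) / \<omega> \<le> region_speed * \<bar>t - s\<bar>"
    using divide_right_mono[OF dist_v[OF assms(1,2)], of \<omega>] \<omega>_pos by (simp add: region_speed_def)
  ultimately show ?thesis by (meson order_trans)
qed

text \<open>
  Moreau's catching-up scheme with step size \<open>h\<close>: an explicit Euler step along the negative gradient,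
  followed by a projection onto the feasible set at the next node.
\<close>
primrec catch_up :: "real \<Rightarrow> real^'n \<Rightarrow> nat \<Rightarrow> real^'n" where
  "catch_up h x0 0 = x0"
| "catch_up h x0 (Suc k) = closest_point (region (real (Suc k) * h))
     (catch_up h x0 k - h *\<^sub>R grad (catch_up h x0 k) (real k * h))"

lemma catch_up_region:
  assumes "h > 0" "x0 \<in> region 0"
  shows "catch_up h x0 k \<in> region (real k * h)"
proof (cases k)
  case (Suc j)
  have "region (real (Suc j) * h) \<noteq> {}" using assms by (intro nonempty) simp
  then show ?thesis unfolding Suc catch_up.simps by (intro closest_point_in_set closed_feasible)
qed (use assms in simp)

text \<open>
  The new iterate is compared with a point \<open>y\<close> of the next feasible set near the old iterate. Since the
  projection is nonexpansive and fixes \<open>y\<close>, the distance is bounded by the motion of the set, counted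
  twice, and the length of the gradient step.
\<close>
lemma catch_up_step:
  assumes h: "h > 0" and x0: "x0 \<in> region 0"
  shows "norm (catch_up h x0 (Suc k) - catch_up h x0 k)
    \<le> h * (2 * region_speed + norm (grad (catch_up h x0 k) (real k * h)))"
proof -
  let ?x = "catch_up h x0 k" and ?R = "region (real (Suc k) * h)"
  let ?g = "grad ?x (real k * h)"
  obtain y where y: "y \<in> ?R" "norm (?x - y) \<le> region_speed * \<bar>real (Suc k) * h - real k * h\<bar>"
    using near_region[OF _ _ catch_up_region[OF h x0, of k], of "real (Suc k) * h"] h by auto
  have "real (Suc k) * h - real k * h = h" by (simp add: algebra_simps)
  then have xy: "norm (?x - y) \<le> region_speed * h" using y(2) h by simp
  have "closest_point ?R y = y" using y(1) by (rule closest_point_self)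
  then have "norm (catch_up h x0 (Suc k) - y) \<le> norm (?x - h *\<^sub>R ?g - y)"
    using closest_point_lipschitz[OF convex_feasible closed_feasible, of U "v (real (Suc k) * h)" "?x - h *\<^sub>R ?g" y] y(1)
    by (auto simp: dist_norm)
  also have "\<dots> \<le> norm (?x - y) + h * norm ?g"
    using norm_triangle_ineq4[of "?x - y" "h *\<^sub>R ?g"] h by (simp add: algebra_simps)
  finally have "norm (catch_up h x0 (Suc k) - ?x) \<le> norm (?x - y) + h * norm ?g + norm (?x - y)"
    using norm_triangle_ineq[of "catch_up h x0 (Suc k) - y" "y - ?x"] by (simp add: norm_minus_commute)
  also have "\<dots> \<le> h * (2 * region_speed + norm ?g)" using xy by (simp add: algebra_simps)
  finally show ?thesis .
qed

text \<open>
  A bound for the distance of the iterates from \<open>x0\<close> that does not depend on the step size. It grows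
  fast enough to absorb one step of the scheme (\<open>radius_step\<close>); its coefficient contains
  \<open>\<beta> * lc\<close> to dominate the linear growth in time of the gradient at \<open>x0\<close>.
\<close>
definition radius :: "real^'n \<Rightarrow> real \<Rightarrow> real" where
  "radius x0 t = (2 * region_speed + norm (grad x0 0) + \<beta> * lc) * exp ((\<beta> + 1) * t)"

text \<open>
  A bound for the step length divided by \<open>h\<close>, valid within the radius.
\<close>
definition rate_bound :: "real^'n \<Rightarrow> real \<Rightarrow> real" where
  "rate_bound x0 t = 2 * region_speed + norm (grad x0 0) + \<beta> * radius x0 t + \<beta> * lc * t"

lemma radius_coeff_nonneg: "0 \<le> 2 * region_speed + norm (grad x0 0) + \<beta> * lc"
  using region_speed_nonneg \<beta>_pos lc_nonneg by simp

lemma radius_nonneg: "0 \<le> radius x0 t"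
  unfolding radius_def using radius_coeff_nonneg by simp

lemma radius_mono: "s \<le> t \<Longrightarrow> radius x0 s \<le> radius x0 t"
  unfolding radius_def using radius_coeff_nonneg \<beta>_pos by (intro mult_left_mono) auto

lemma rate_bound_mono: "s \<le> t \<Longrightarrow> rate_bound x0 s \<le> rate_bound x0 t"
  unfolding rate_bound_def using radius_mono[of s t x0] \<beta>_pos lc_nonneg
  by (intro add_mono mult_left_mono) auto

lemma rate_bound_nonneg: "0 \<le> t \<Longrightarrow> 0 \<le> rate_bound x0 t"
  unfolding rate_bound_def using radius_nonneg[of x0 t] \<beta>_pos lc_nonneg region_speed_nonneg by simp

lemma grad_le_rate_bound:
  assumes "0 \<le> t" "norm (x - x0) \<le> radius x0 t"
  shows "2 * region_speed + norm (grad x t) \<le> rate_bound x0 t"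
proof -
  have "norm (grad x t) \<le> norm (grad x0 0) + \<beta> * (norm (x - x0) + lc * \<bar>t - 0\<bar>)"
    using grad_dist[of 0 t x x0] assms norm_triangle_sub[of "grad x t" "grad x0 0"] by simp
  also have "\<dots> \<le> norm (grad x0 0) + \<beta> * (radius x0 t + lc * t)"
    using assms \<beta>_pos by simp
  finally show ?thesis by (simp add: rate_bound_def algebra_simps)
qed

lemma radius_step:
  assumes "0 \<le> t" "0 < h"
  shows "radius x0 t + h * rate_bound x0 t \<le> radius x0 (t + h)"
proof -
  define A where "A = 2 * region_speed + norm (grad x0 0)"
  define B where "B = \<beta> * lc"
  have AB: "A \<ge> 0" "B \<ge> 0" using region_speed_nonneg \<beta>_pos lc_nonneg by (auto simp: A_def B_def)
  have "t \<le> (\<beta> + 1) * t" using \<beta>_pos \<open>0 \<le> t\<close> by (simp add: distrib_right)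
  then have "1 + t \<le> exp ((\<beta> + 1) * t)" using exp_ge_add_one_self[of "(\<beta> + 1) * t"] by linarith
  then have "(A + B) * (1 + t) \<le> radius x0 t"
    unfolding radius_def A_def[symmetric] B_def[symmetric] using AB by (intro mult_left_mono) auto
  moreover have "A + B * t \<le> (A + B) * (1 + t)"
    using AB \<open>0 \<le> t\<close> by (simp add: algebra_simps)
  ultimately have "rate_bound x0 t \<le> (\<beta> + 1) * radius x0 t"
    by (simp add: rate_bound_def A_def B_def algebra_simps)
  then have "radius x0 t + h * rate_bound x0 t \<le> radius x0 t * (1 + (\<beta> + 1) * h)"
    using mult_left_mono[of "rate_bound x0 t" "(\<beta> + 1) * radius x0 t" h] \<open>0 < h\<close> by (simp add: algebra_simps)
  also have "\<dots> \<le> radius x0 t * exp ((\<beta> + 1) * h)"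
    using radius_nonneg by (intro mult_left_mono exp_ge_add_one_self)
  also have "\<dots> = radius x0 (t + h)"
    by (simp add: radius_def exp_add[symmetric] distrib_left)
  finally show ?thesis .
qed

lemma catch_up_bounds:
  assumes h: "h > 0" and x0: "x0 \<in> region 0"
  shows catch_up_radius: "norm (catch_up h x0 k - x0) \<le> radius x0 (real k * h)"
    and catch_up_grad: "norm (grad (catch_up h x0 k) (real k * h)) \<le> rate_bound x0 (real k * h)"
    and catch_up_increment: "norm (catch_up h x0 (Suc k) - catch_up h x0 k) \<le> h * rate_bound x0 (real k * h)"
proof -
  have incr: "norm (catch_up h x0 (Suc k) - catch_up h x0 k) \<le> h * rate_bound x0 (real k * h)"
    if "norm (catch_up h x0 k - x0) \<le> radius x0 (real k * h)" for k
    using catch_up_step[OF h x0, of k] grad_le_rate_bound[OF _ that] h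
    by (meson mult_left_mono less_imp_le mult_nonneg_nonneg of_nat_0_le_iff order_trans)
  show 1: "norm (catch_up h x0 k - x0) \<le> radius x0 (real k * h)"
  proof (induction k)
    case (Suc k)
    have "norm (catch_up h x0 (Suc k) - x0)
        \<le> norm (catch_up h x0 k - x0) + norm (catch_up h x0 (Suc k) - catch_up h x0 k)"
      using norm_triangle_ineq[of "catch_up h x0 k - x0" "catch_up h x0 (Suc k) - catch_up h x0 k"] by simp
    also have "\<dots> \<le> radius x0 (real k * h) + h * rate_bound x0 (real k * h)"
      using Suc incr[OF Suc] by (rule add_mono)
    also have "\<dots> \<le> radius x0 (real k * h + h)"
      using h by (intro radius_step) auto
    finally show ?case by (simp add: algebra_simps)
  qed (simp add: radius_nonneg)
  show "norm (catch_up h x0 (Suc k) - catch_up h x0 k) \<le> h * rate_bound x0 (real k * h)"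
    by (rule incr[OF 1])
  show "norm (grad (catch_up h x0 k) (real k * h)) \<le> rate_bound x0 (real k * h)"
    using grad_le_rate_bound[OF _ 1] h region_speed_nonneg by simp
qed

lemma catch_up_lipschitz:
  assumes h: "h > 0" and x0: "x0 \<in> region 0" and kl: "k \<le> l" and M: "real l * h \<le> T"
  shows "norm (catch_up h x0 l - catch_up h x0 k) \<le> rate_bound x0 T * (real (l - k) * h)"
  using kl M
proof (induction l rule: dec_induct)
  case (step l)
  have lT: "real l * h \<le> T" using step.prems h by (simp add: algebra_simps)
  have "norm (catch_up h x0 (Suc l) - catch_up h x0 k)
      \<le> norm (catch_up h x0 l - catch_up h x0 k) + norm (catch_up h x0 (Suc l) - catch_up h x0 l)"
    using norm_triangle_ineq[of "catch_up h x0 l - catch_up h x0 k" "catch_up h x0 (Suc l) - catch_up h x0 l"] by simp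
  also have "\<dots> \<le> rate_bound x0 T * (real (l - k) * h) + h * rate_bound x0 T"
    using step.IH[OF lT] catch_up_increment[OF h x0, of l] mult_left_mono[OF rate_bound_mono[OF lT, of x0], of h] h by linarith
  also have "\<dots> = rate_bound x0 T * (real (Suc l - k) * h)"
    using step.hyps by (simp add: Suc_diff_le algebra_simps)
  finally show ?case .
qed simp

text \<open>
  The vector \<open>p\<close> from the new iterate to the point that was projected is normal to the feasible set at
  node \<open>Suc j\<close>. Three replacements lead to the claim: \<open>z\<close> is exchanged for a nearby point of that set,
  the new iterate for \<open>xk\<close>, and the gradient at node \<open>j\<close> for the one at node \<open>k\<close>. The first
  two cost \<open>O(h * \<tau>)\<close> and the third \<open>O(h * \<tau> * \<parallel>z - xk\<parallel>)\<close>, where \<open>\<tau>\<close> bounds the time from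
  node \<open>k\<close> to node \<open>Suc j\<close>.
\<close>
lemma catch_up_step_variational:
  assumes h: "h > 0" and x0: "x0 \<in> region 0" and kj: "k \<le> j" and T: "real (Suc j) * h \<le> T"
    and \<tau>: "real (Suc j - k) * h \<le> \<tau>" and z: "z \<in> region (real k * h)"
  defines "M \<equiv> rate_bound x0 T" and "xk \<equiv> catch_up h x0 k"
  shows "- (h * \<tau> * (2 * M * (region_speed + M) + \<beta> * (M + lc) * norm (z - xk)))
    \<le> (catch_up h x0 (Suc j) - catch_up h x0 j + h *\<^sub>R grad xk (real k * h)) \<bullet> (z - xk)"
proof -
  let ?x = "catch_up h x0 j" and ?x' = "catch_up h x0 (Suc j)"
  let ?g = "grad ?x (real j * h)"
  have jT: "real j * h \<le> T"
    using T h by (simp add: algebra_simps)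
  have "real (j - k) * h \<le> real (Suc j - k) * h"
    using h by (intro mult_right_mono) auto
  then have \<tau>': "real (j - k) * h \<le> \<tau>" using \<tau> by linarith
  moreover have "0 \<le> real (j - k) * h" using h by simp
  ultimately have \<tau>0: "\<tau> \<ge> 0" by linarith
  have "0 \<le> real (Suc j) * h" using h by simp
  then have T0: "0 \<le> T" using T by linarith
  have M0: "M \<ge> 0" unfolding M_def using T0 by (rule rate_bound_nonneg)
  define p where "p = ?x - h *\<^sub>R ?g - ?x'"
  have normal: "p \<bullet> (y - ?x') \<le> 0" if "y \<in> region (real (Suc j) * h)" for y
    unfolding p_def catch_up.simps using convex_feasible closed_feasible that by (rule closest_point_dot)
  have "norm p \<le> norm (?x' - ?x) + h * norm ?g"
    using norm_triangle_ineq4[of "?x - ?x'" "h *\<^sub>R ?g"] h by (simp add: p_def algebra_simps norm_minus_commute)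
  also have "\<dots> \<le> h * M + h * M"
    using catch_up_increment[OF h x0, of j] catch_up_grad[OF h x0, of j] rate_bound_mono[OF jT, of x0] h
    unfolding M_def by (intro add_mono) (meson mult_left_mono less_imp_le order_trans)+
  finally have np: "norm p \<le> 2 * h * M" by (simp add: mult_ac)
  obtain z' where z': "z' \<in> region (real (Suc j) * h)" "norm (z - z') \<le> region_speed * \<bar>real (Suc j) * h - real k * h\<bar>"
    using near_region[OF _ \<open>0 \<le> real (Suc j) * h\<close> z] h by (meson less_imp_le mult_nonneg_nonneg of_nat_0_le_iff)
  have "real (Suc j) * h - real k * h = real (Suc j - k) * h"
    using kj by (simp add: of_nat_diff algebra_simps)
  then have zz': "norm (z - z') \<le> region_speed * \<tau>"
    using z'(2) \<tau> region_speed_nonneg h by (simp add: mult_left_mono order_trans)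
  have "norm (?x' - xk) \<le> M * \<tau>"
    using catch_up_lipschitz[OF h x0, of k "Suc j" T] kj T \<tau> M0 unfolding M_def xk_def
    by (meson mult_left_mono order_trans le_SucI)
  then have "norm ((z - z') + (?x' - xk)) \<le> (region_speed + M) * \<tau>"
    using zz' norm_triangle_ineq[of "z - z'" "?x' - xk"] by (simp add: distrib_right)
  then have "norm p * norm ((z - z') + (?x' - xk)) \<le> 2 * h * M * ((region_speed + M) * \<tau>)"
    using np h M0 by (intro mult_mono) auto
  then have "p \<bullet> ((z - z') + (?x' - xk)) \<le> 2 * h * M * ((region_speed + M) * \<tau>)"
    using norm_cauchy_schwarz[of p "(z - z') + (?x' - xk)"] by linarith
  then have p: "p \<bullet> (z - xk) \<le> 2 * h * M * ((region_speed + M) * \<tau>)"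
    using normal[OF z'(1)] by (simp add: algebra_simps)
  have "norm (?g - grad xk (real k * h)) \<le> \<beta> * (norm (?x - xk) + lc * \<bar>real j * h - real k * h\<bar>)"
    using h by (intro grad_dist) auto
  also have "\<dots> \<le> \<beta> * (M * \<tau> + lc * \<tau>)"
  proof -
    have "real j * h - real k * h = real (j - k) * h" using kj by (simp add: of_nat_diff algebra_simps)
    then have "\<bar>real j * h - real k * h\<bar> \<le> \<tau>" using \<tau>' h by simp
    moreover have "norm (?x - xk) \<le> M * \<tau>"
      using catch_up_lipschitz[OF h x0 kj jT] \<tau>' M0 unfolding M_def xk_def
      by (meson mult_left_mono order_trans)
    ultimately show ?thesis using \<beta>_pos lc_nonneg by (intro mult_left_mono add_mono) auto
  qed
  finally have "norm (?g - grad xk (real k * h)) * norm (z - xk) \<le> \<beta> * (M * \<tau> + lc * \<tau>) * norm (z - xk)"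
    by (rule mult_right_mono) simp
  then have "(?g - grad xk (real k * h)) \<bullet> (z - xk) \<le> \<beta> * (M * \<tau> + lc * \<tau>) * norm (z - xk)"
    using norm_cauchy_schwarz[of "?g - grad xk (real k * h)" "z - xk"] by linarith
  then have "h * ((?g - grad xk (real k * h)) \<bullet> (z - xk)) \<le> h * (\<beta> * (M * \<tau> + lc * \<tau>) * norm (z - xk))"
    using h by simp
  moreover have "(?x' - ?x + h *\<^sub>R grad xk (real k * h)) \<bullet> (z - xk)
      = - (p \<bullet> (z - xk)) - h * ((?g - grad xk (real k * h)) \<bullet> (z - xk))"
    by (simp add: p_def algebra_simps)
  ultimately show ?thesis using p by (simp add: algebra_simps)
qed

text \<open>
  Base point, gradient and test point are frozen at node \<open>k\<close>, so the inequalities of the single steps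
  add up telescopically. The error is quadratic in \<open>\<tau>\<close>, with constants independent of the step size.
\<close>
lemma catch_up_variational:
  assumes h: "h > 0" and x0: "x0 \<in> region 0" and kl: "k \<le> l" and T: "real l * h \<le> T"
    and z: "z \<in> region (real k * h)"
  defines "M \<equiv> rate_bound x0 T" and "xk \<equiv> catch_up h x0 k" and "\<tau> \<equiv> real l * h - real k * h"
  shows "- (\<tau>\<^sup>2 * (2 * M * (region_speed + M) + \<beta> * (M + lc) * norm (z - xk)))
    \<le> (catch_up h x0 l - xk + \<tau> *\<^sub>R grad xk (real k * h)) \<bullet> (z - xk)"
proof -
  let ?C = "2 * M * (region_speed + M) + \<beta> * (M + lc) * norm (z - xk)"
  have "- (real (j - k) * h * \<tau> * ?C)
    \<le> (catch_up h x0 j - xk + (real (j - k) * h) *\<^sub>R grad xk (real k * h)) \<bullet> (z - xk)" if "k \<le> j" "j \<le> l" for j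
    using that
  proof (induction j rule: dec_induct)
    case (step j)
    have "real (Suc j) * h \<le> real l * h" using step.prems h by (intro mult_right_mono) auto
    then have "real (Suc j) * h \<le> T" "real (Suc j - k) * h \<le> \<tau>"
      using T step.hyps by (auto simp: \<tau>_def of_nat_diff algebra_simps)
    then have "- (h * \<tau> * ?C) \<le> (catch_up h x0 (Suc j) - catch_up h x0 j + h *\<^sub>R grad xk (real k * h)) \<bullet> (z - xk)"
      unfolding M_def xk_def using step.hyps by (intro catch_up_step_variational h x0 z) auto
    moreover have "- (real (j - k) * h * \<tau> * ?C)
      \<le> (catch_up h x0 j - xk + (real (j - k) * h) *\<^sub>R grad xk (real k * h)) \<bullet> (z - xk)"
      using step by simp
    moreover have "real (Suc j - k) = real (j - k) + 1" using step.hyps by (simp add: Suc_diff_le)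
    ultimately show ?case by (simp only: inner_add_left inner_diff_left inner_scaleR_left) (simp add: algebra_simps)
  qed (simp add: xk_def)
  from this[OF kl order_refl] show ?thesis
    using kl by (simp add: \<tau>_def of_nat_diff power2_eq_square left_diff_distrib)
qed

text \<open>
  Each approximation is constant between its nodes, so its values at the times \<open>s\<close> and \<open>t\<close> belong to the
  nodes just before them, which converge to \<open>s\<close> and \<open>t\<close>. All estimates of the scheme are closed
  conditions on finitely many values and pass to the limit.
\<close>
lemma limit_trajectory:
  assumes x0: "x0 \<in> region 0"
  obtains x where "x 0 = x0" "\<And>t. 0 \<le> t \<Longrightarrow> x t \<in> region t"
    "\<And>s t. 0 \<le> s \<Longrightarrow> s \<le> t \<Longrightarrow> norm (x t - x s) \<le> rate_bound x0 t * (t - s)"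
    "\<And>s t z M. 0 \<le> s \<Longrightarrow> s \<le> t \<Longrightarrow> z \<in> region s \<Longrightarrow> M = rate_bound x0 t \<Longrightarrow>
      - ((t - s)\<^sup>2 * (2 * M * (region_speed + M) + \<beta> * (M + lc) * norm (z - x s)))
      \<le> (x t - x s + (t - s) *\<^sub>R grad (x s) s) \<bullet> (z - x s)"
proof -
  define h :: "nat \<Rightarrow> real" where "h n = inverse (real (Suc n))" for n
  have h: "h n > 0" for n by (simp add: h_def)
  have h0: "h \<longlonglongrightarrow> 0" unfolding h_def by (rule LIMSEQ_inverse_real_of_nat)
  define k where "k n t = nat \<lfloor>t / h n\<rfloor>" for n t
  define node where "node n t = real (k n t) * h n" for n t
  define y where "y n t = catch_up (h n) x0 (k n t)" for n t
  have node_nonneg: "0 \<le> node n t" for n t using h[of n] by (simp add: node_def)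
  have node: "node n t \<le> t" "t - h n \<le> node n t" if "0 \<le> t" for n t
  proof -
    have "real (k n t) = of_int \<lfloor>t / h n\<rfloor>" using that h[of n] by (simp add: k_def)
    moreover have "of_int \<lfloor>t / h n\<rfloor> \<le> t / h n" "t / h n < of_int \<lfloor>t / h n\<rfloor> + 1" by linarith+
    ultimately have "real (k n t) \<le> t / h n" "t / h n \<le> real (k n t) + 1" by linarith+
    then show "node n t \<le> t" "t - h n \<le> node n t"
      using h[of n] by (simp_all add: node_def field_simps)
  qed
  have k_mono: "k n s \<le> k n t" if "s \<le> t" for n s t
    unfolding k_def using that h[of n] by (intro nat_mono floor_mono divide_right_mono) auto
  have "y n t \<in> cball x0 (radius x0 t)" for n t
  proof (cases "0 \<le> t")
    case True
    have "norm (y n t - x0) \<le> radius x0 (node n t)"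
      unfolding y_def node_def by (rule catch_up_radius[OF h x0])
    also have "\<dots> \<le> radius x0 t" using node(1)[OF True] by (rule radius_mono)
    finally show ?thesis by (simp add: dist_norm norm_minus_commute)
  next
    case False
    then have "t / h n < 0" using h[of n] by (simp add: divide_neg_pos)
    then have "k n t = 0" by (simp add: k_def)
    then show ?thesis by (simp add: y_def radius_nonneg)
  qed
  then obtain F x where F: "F \<noteq> bot" "F \<le> sequentially" and lim: "\<And>t. ((\<lambda>n. y n t) \<longlongrightarrow> x t) F"
    using pointwise_cluster_function[of y x0 "radius x0"] by blast
  have node_lim: "((\<lambda>n. node n t) \<longlongrightarrow> t) F" if t: "0 \<le> t" for t
  proof (rule tendsto_mono[OF F(2)], rule real_tendsto_sandwich[where f = "\<lambda>n. t - h n" and h = "\<lambda>_. t"])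
    show "(\<lambda>n. t - h n) \<longlonglongrightarrow> t" using tendsto_diff[OF tendsto_const h0, of t] by simp
  qed (use node[OF t] in auto)
  have v_lim: "((\<lambda>n. v (node n t)) \<longlongrightarrow> v t) F" and c_lim: "((\<lambda>n. c (node n t)) \<longlongrightarrow> c t) F" if t: "0 \<le> t" for t
    using lipschitz_on_continuous_on[OF lip_v] lipschitz_on_continuous_on[OF lip_c] node_lim[OF t] t node_nonneg
    by (auto intro: continuous_on_tendsto_compose)
  have grad_lim: "((\<lambda>n. grad (y n t) (node n t)) \<longlongrightarrow> grad (x t) t) F" if t: "0 \<le> t" for t
    using lipschitz_on_continuous_on[OF lip]
    by (rule continuous_on_tendsto_compose) (auto intro: tendsto_diff lim c_lim[OF t])
  have y_region: "y n t \<in> region (node n t)" for n t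
    unfolding y_def node_def by (rule catch_up_region[OF h x0])
  show ?thesis
  proof (rule that)
    have "y n 0 = x0" for n by (simp add: y_def k_def)
    then show "x 0 = x0" using lim[of 0] F(1) by (simp add: tendsto_const_iff)
    show "x t \<in> region t" if t: "0 \<le> t" for t
      unfolding mem_feasible_iff
    proof
      fix i
      show "U $ i \<bullet> x t \<le> v t $ i"
      proof (rule tendsto_le[OF F(1)])
        show "((\<lambda>n. v (node n t) $ i) \<longlongrightarrow> v t $ i) F" by (intro tendsto_intros v_lim t)
        show "((\<lambda>n. U $ i \<bullet> y n t) \<longlongrightarrow> U $ i \<bullet> x t) F" by (intro tendsto_intros lim)
        show "\<forall>\<^sub>F n in F. U $ i \<bullet> y n t \<le> v (node n t) $ i"
          using y_region by (simp add: mem_feasible_iff)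
      qed
    qed
    fix s t :: real assume st: "0 \<le> s" "s \<le> t"
    then have t: "0 \<le> t" by simp
    have kl: "k n s \<le> k n t" and kt: "real (k n t) * h n \<le> t" for n
      using k_mono[OF st(2)] node(1)[OF t, of n] by (auto simp: node_def)
    show "norm (x t - x s) \<le> rate_bound x0 t * (t - s)"
    proof (rule tendsto_le[OF F(1)])
      show "((\<lambda>n. rate_bound x0 t * (node n t - node n s)) \<longlongrightarrow> rate_bound x0 t * (t - s)) F"
        by (intro tendsto_intros node_lim st t)
      show "((\<lambda>n. norm (y n t - y n s)) \<longlongrightarrow> norm (x t - x s)) F"
        by (intro tendsto_intros lim)
      have "norm (y n t - y n s) \<le> rate_bound x0 t * (node n t - node n s)" for n
        using catch_up_lipschitz[OF h x0 kl kt] kl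
        by (simp add: y_def node_def of_nat_diff left_diff_distrib)
      then show "\<forall>\<^sub>F n in F. norm (y n t - y n s) \<le> rate_bound x0 t * (node n t - node n s)" by simp
    qed
    fix z M assume z: "z \<in> region s" and M: "M = rate_bound x0 t"
    have "\<exists>y\<in>region (node n s). norm (z - y) \<le> region_speed * \<bar>node n s - s\<bar>" for n
      using near_region[OF st(1) node_nonneg z] .
    then obtain zn where zn: "\<And>n. zn n \<in> region (node n s)" "\<And>n. norm (z - zn n) \<le> region_speed * \<bar>node n s - s\<bar>"
      by metis
    have "((\<lambda>n. region_speed * \<bar>node n s - s\<bar>) \<longlongrightarrow> region_speed * \<bar>s - s\<bar>) F"
      by (intro tendsto_intros node_lim st)
    then have gap: "((\<lambda>n. region_speed * \<bar>node n s - s\<bar>) \<longlongrightarrow> 0) F" by simp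
    have "((\<lambda>n. z - zn n) \<longlongrightarrow> 0) F"
      by (rule Lim_null_comparison[OF _ gap]) (use zn(2) in simp)
    then have "((\<lambda>n. z - (z - zn n)) \<longlongrightarrow> z - 0) F"
      by (rule tendsto_diff[OF tendsto_const])
    then have zn_lim: "(zn \<longlongrightarrow> z) F" by simp
    let ?\<tau> = "\<lambda>n. node n t - node n s"
    show "- ((t - s)\<^sup>2 * (2 * M * (region_speed + M) + \<beta> * (M + lc) * norm (z - x s)))
      \<le> (x t - x s + (t - s) *\<^sub>R grad (x s) s) \<bullet> (z - x s)"
    proof (rule tendsto_le[OF F(1)])
      show "((\<lambda>n. (y n t - y n s + ?\<tau> n *\<^sub>R grad (y n s) (node n s)) \<bullet> (zn n - y n s))
          \<longlongrightarrow> (x t - x s + (t - s) *\<^sub>R grad (x s) s) \<bullet> (z - x s)) F"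
        by (intro tendsto_intros lim node_lim st t grad_lim zn_lim)
      show "((\<lambda>n. - ((?\<tau> n)\<^sup>2 * (2 * M * (region_speed + M) + \<beta> * (M + lc) * norm (zn n - y n s))))
          \<longlongrightarrow> - ((t - s)\<^sup>2 * (2 * M * (region_speed + M) + \<beta> * (M + lc) * norm (z - x s)))) F"
        by (intro tendsto_intros lim node_lim st t zn_lim)
      have "- ((?\<tau> n)\<^sup>2 * (2 * M * (region_speed + M) + \<beta> * (M + lc) * norm (zn n - y n s)))
          \<le> (y n t - y n s + ?\<tau> n *\<^sub>R grad (y n s) (node n s)) \<bullet> (zn n - y n s)" for n
        using catch_up_variational[OF h x0 kl[of n] kt[of n], of "zn n"] zn(1)[of n]
        unfolding M y_def node_def by blast
      then show "\<forall>\<^sub>F n in F. - ((?\<tau> n)\<^sup>2 * (2 * M * (region_speed + M) + \<beta> * (M + lc) * norm (zn n - y n s)))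
          \<le> (y n t - y n s + ?\<tau> n *\<^sub>R grad (y n s) (node n s)) \<bullet> (zn n - y n s)" by simp
    qed
  qed
qed

text \<open>
  At a point of differentiability the quadratic error of the variational inequality disappears after
  division by the elapsed time; what remains says that minus the gradient minus the velocity is normal
  to the feasible set.
\<close>
lemma complete_solution_exists:
  assumes x0: "x0 \<in> region 0"
  shows "\<exists>x. complete_sweeping_solution drift region x \<and> x 0 = x0"
proof -
  obtain x where start: "x 0 = x0" and feas: "\<And>t. 0 \<le> t \<Longrightarrow> x t \<in> region t"
    and lip: "\<And>s t. 0 \<le> s \<Longrightarrow> s \<le> t \<Longrightarrow> norm (x t - x s) \<le> rate_bound x0 t * (t - s)"
    and vi: "\<And>s t z M. 0 \<le> s \<Longrightarrow> s \<le> t \<Longrightarrow> z \<in> region s \<Longrightarrow> M = rate_bound x0 t \<Longrightarrow>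
      - ((t - s)\<^sup>2 * (2 * M * (region_speed + M) + \<beta> * (M + lc) * norm (z - x s)))
      \<le> (x t - x s + (t - s) *\<^sub>R grad (x s) s) \<bullet> (z - x s)"
    using limit_trajectory[OF x0] by blast
  have "sweeping_solution drift region T x" if T: "T > 0" for T
  proof -
    define L where "L = rate_bound x0 T"
    have L0: "L \<ge> 0" unfolding L_def using T by (intro rate_bound_nonneg) simp
    have dist: "norm (x t - x s) \<le> L * (t - s)" if "0 \<le> s" "s \<le> t" "t \<le> T" for s t
      using lip[OF that(1,2)] mult_right_mono[OF rate_bound_mono[OF that(3), of x0], of "t - s"] that
      by (simp add: L_def)
    have lipL: "L-lipschitz_on {0..T} x"
    proof (rule lipschitz_onI[OF _ L0])
      fix s t assume "s \<in> {0..T}" "t \<in> {0..T}"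
      then show "dist (x s) (x t) \<le> L * dist s t"
        using dist[of s t] dist[of t s] by (cases "s \<le> t") (auto simp: dist_norm norm_minus_commute abs_if)
    qed
    obtain N where N: "negligible N" and der: "\<And>t. t \<in> {0<..<T} - N \<Longrightarrow> x differentiable at t"
      using lipschitz_differentiable_ae[OF lipL] by blast
    have incl: "\<exists>p\<in>drift (x t) t. \<exists>\<eta>\<in>normal_cone (region t) (x t).
        (x has_vector_derivative (p - \<eta>)) (at t within {0..T})" if t: "t \<in> {0<..<T} - N" for t
    proof -
      obtain w where w: "(x has_vector_derivative w) (at t)"
        using der[OF t] vector_derivative_works by blast
      have "0 \<le> (w + grad (x t) t) \<bullet> (z - x t)" if z: "z \<in> region t" for z
      proof (rule tendsto_le[OF trivial_limit_at_right_real])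
        define d where "d = z - x t"
        have "((\<lambda>s. x s \<bullet> d) has_real_derivative w \<bullet> d) (at t)"
          using w unfolding has_vector_derivative_def has_field_derivative_def
          by (auto intro!: derivative_eq_intros simp: mult_commute_abs)
        then have "((\<lambda>h. (x (t + h) \<bullet> d - x t \<bullet> d) / h) \<longlongrightarrow> w \<bullet> d) (at_right 0)"
          unfolding DERIV_def by (rule filterlim_mono) (auto simp: at_le)
        then show "((\<lambda>h. (x (t + h) \<bullet> d - x t \<bullet> d) / h + grad (x t) t \<bullet> d) \<longlongrightarrow> (w + grad (x t) t) \<bullet> (z - x t)) (at_right 0)"
          unfolding inner_add_left d_def by (rule tendsto_add[OF _ tendsto_const])
        define C where "C = 2 * L * (region_speed + L) + \<beta> * (L + lc) * norm (z - x t)"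
        have "((\<lambda>h. - (h * C)) \<longlongrightarrow> - (0 * C)) (at_right 0)"
          by (intro tendsto_intros)
        then show "((\<lambda>h. - (h * C)) \<longlongrightarrow> 0) (at_right 0)" by simp
        have "- (h * C) \<le> (x (t + h) \<bullet> d - x t \<bullet> d) / h + grad (x t) t \<bullet> d" if h: "0 < h" "h < T - t" for h
        proof -
          define M where "M = rate_bound x0 (t + h)"
          have M: "0 \<le> M" "M \<le> L"
            unfolding M_def L_def using t h by (auto intro: rate_bound_nonneg rate_bound_mono)
          have "2 * M * (region_speed + M) + \<beta> * (M + lc) * norm (z - x t) \<le> C"
            unfolding C_def using M region_speed_nonneg \<beta>_pos lc_nonneg
            by (intro add_mono mult_mono mult_right_mono mult_left_mono) auto
          then have "h\<^sup>2 * (2 * M * (region_speed + M) + \<beta> * (M + lc) * norm (z - x t)) \<le> h\<^sup>2 * C"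
            by (rule mult_left_mono) simp
          moreover have "- (h\<^sup>2 * (2 * M * (region_speed + M) + \<beta> * (M + lc) * norm (z - x t)))
              \<le> (x (t + h) - x t + h *\<^sub>R grad (x t) t) \<bullet> (z - x t)"
            using vi[of t "t + h" z M] t h z by (simp add: M_def)
          ultimately have "- (h\<^sup>2 * C) \<le> (x (t + h) - x t + h *\<^sub>R grad (x t) t) \<bullet> (z - x t)"
            by linarith
          also have "\<dots> = h * ((x (t + h) \<bullet> d - x t \<bullet> d) / h + grad (x t) t \<bullet> d)"
            using h by (simp add: d_def[symmetric] inner_add_left inner_diff_left distrib_left)
          finally have "h * (- (h * C)) \<le> h * ((x (t + h) \<bullet> d - x t \<bullet> d) / h + grad (x t) t \<bullet> d)"
            by (simp add: power2_eq_square mult.assoc)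
          then show ?thesis using h by (simp only: mult_le_cancel_left_pos)
        qed
        then show "\<forall>\<^sub>F h in at_right 0. - (h * C) \<le> (x (t + h) \<bullet> d - x t \<bullet> d) / h + grad (x t) t \<bullet> d"
          using eventually_at_right_real[of 0 "T - t"] t by (auto elim: eventually_mono)
      qed
      then have "- grad (x t) t - w \<in> normal_cone (region t) (x t)"
        by (auto simp: normal_cone_eq algebra_simps)
      moreover have "(x has_vector_derivative (- grad (x t) t - (- grad (x t) t - w))) (at t within {0..T})"
        using w by (simp add: has_vector_derivative_at_within)
      ultimately show ?thesis by blast
    qed
    have "N \<union> {0, T} \<in> null_sets lebesgue"
      using N negligible_Un[OF N negligible_finite[of "{0, T}"]] by (simp add: negligible_iff_null_sets)
    then have "AE t in lebesgue. t \<notin> N \<union> {0, T}" by (rule AE_not_in)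
    then have "AE t in lebesgue. t \<in> {0..T} \<longrightarrow> (\<exists>p\<in>drift (x t) t. \<exists>\<eta>\<in>normal_cone (region t) (x t).
        (x has_vector_derivative (p - \<eta>)) (at t within {0..T}))"
      by eventually_elim (use incl in auto)
    then have "AE t in lebesgue_on {0..T}. \<exists>p\<in>drift (x t) t. \<exists>\<eta>\<in>normal_cone (region t) (x t).
        (x has_vector_derivative (p - \<eta>)) (at t within {0..T})"
      by (subst AE_restrict_space_iff) auto
    then show ?thesis
      using lipschitz_imp_absolutely_continuous_on[OF lipL] feas by (simp add: sweeping_solution_def)
  qed
  then show ?thesis using start by (auto simp: complete_sweeping_solution_def)
qed

end

section \<open>The sweeping gradient flow\<close>

theorem theorem12:
  fixes f :: "real^'n \<Rightarrow> real" and c :: "real \<Rightarrow> real^'n" and v :: "real \<Rightarrow> real^'m"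
    and U :: "real^'n^'m" and \<alpha> \<beta> \<omega> lc lv :: real
    and X :: "real \<Rightarrow> (real^'n) set" and \<Phi> :: "real^'n \<Rightarrow> real \<Rightarrow> (real^'n) set"
    and xstar :: "real \<Rightarrow> real^'n"
  assumes "twice_continuously_differentiable f"
    and "strongly_convex \<alpha> f"
    and "\<beta>-lipschitz_on UNIV (gradient f)"
    and "lc-lipschitz_on {0..} c"
    and "lv-lipschitz_on {0..} v"
    and X_def: "X = (\<lambda>t. feasible U (v t))"
    and "0 < \<omega>"
    and "\<And>t x. t \<ge> 0 \<Longrightarrow> x \<in> X t \<Longrightarrow>
           loewner_le_on (active U (v t) x) (scaled_identity (\<omega>\<^sup>2))
             (times_transpose (row_submatrix U (active U (v t) x)))"
    and "\<And>t. t \<ge> 0 \<Longrightarrow> X t \<noteq> {}"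
    and \<Phi>_def: "\<Phi> = (\<lambda>x t. {- gradient f (x - c t)})"
    and xstar_def: "xstar = (\<lambda>t. arg_min_on (\<lambda>x. f (x - c t)) (X t))"
  shows "let r = \<beta> powr (1/2) / \<alpha> powr (3/2) * (\<beta> * lc / \<alpha> + lv / \<omega>) in
     (\<forall>t\<ge>0. \<exists>!x. is_arg_min (\<lambda>x. f (x - c t)) (\<lambda>x. x \<in> X t) x) \<and>
     (\<forall>x0\<in>X 0. \<exists>x. complete_sweeping_solution \<Phi> X x \<and> x 0 = x0) \<and>
     (\<forall>x. complete_sweeping_solution \<Phi> X x \<longrightarrow>
        Limsup at_top (\<lambda>t. ereal (norm (x t - xstar t))) \<le> ereal r \<and>
        (norm (x 0 - xstar 0) \<le> r \<longrightarrow> (\<forall>t\<ge>0. norm (x t - xstar t) \<le> r)))"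
proof -
  interpret moving_polyhedron_problem f c v U \<alpha> \<beta> \<omega> lc lv
  proof
    show "f differentiable at x" for x
      using assms(1) by (simp add: twice_continuously_differentiable_def)
    show "\<omega>\<^sup>2 * (\<Sum>i\<in>active U (v t) x. (z i)\<^sup>2) \<le> (norm (\<Sum>i\<in>active U (v t) x. z i *\<^sub>R U $ i))\<^sup>2"
      if "t \<ge> 0" "x \<in> feasible U (v t)" for t x z
      using assms(8)[OF that(1)] that(2) by (intro loewner_le_row_combination) (simp add: X_def)
  qed (use assms in auto)
  have "xstar = xopt"
    by (simp add: fun_eq_iff xstar_def xopt_def opt_def X_def)
  then show ?thesis
    unfolding Let_def X_def \<Phi>_def
    using ex1_opt[OF nonempty] complete_solution_exists ultimate_tracking_error[OF _ speed_div_\<alpha>_le]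
    by blast
qed

end
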